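(* Let $\sigma>1$, $N\in\mathbb{N}$, and $m_1,\dots,m_N\in(0,1)$ with $\sum_{i=1}^N m_i=1$. If the $\sigma$-homogeneous mechanical system with Lagrangian $\mathcal{L}(\xi,\vec{v})=\sum_{i=1}^N m_i|v_i+\xi|^\sigma$ is mobilized, then there exists a maximizer of the efficiency $e_\sigma$ in $\Lambda_\sigma$, i.e. some $\vec{y}\in\Lambda_\sigma$ (with $e_\sigma(\vec y)$ defined) such that $e_\sigma(\vec{y})=\overline{e}_\sigma$, and moreover $\overline{e}_\sigma<1$.
   Context: Fix $\sigma>1$, $N\in\mathbb{N}$ and masses $m_1,\dots,m_N\in(0,1)$ with $\sum_i m_i=1$. $H^\sigma$ is the set of (absolutely continuous) functions $x:[0,1]\to\mathbb{R}$ with $\int_0^1|\dot x|^\sigma dt<\infty$, and $\Lambda_\sigma=\{\vec y=(y_1,\dots,y_N)\in(H^\sigma)^N:\ \vec y(0)=\vec y(1)\}$. For $\xi\in\mathbb{R}$ and $\vec v\in\mathbb{R}^N$ let $\mathcal{L}(\xi,\vec v)=\sum_{i=1}^N m_i|v_i+\xi|^\sigma$. For $p\in\mathbb{R}$ let $\mathcal{H}(p,\vec v)=\sup_{\xi\in\mathbb{R}}\{p\xi-\mathcal{L}(\xi,\vec v)\}$, and let $u(\vec v)=\frac{\partial\mathcal{H}}{\partial p}(p,\vec v)\big|_{p=0}$ (equivalently, $u(\vec v)$ is the unique minimizer of $\xi\mapsto\mathcal{L}(\xi,\vec v)$, and $-\mathcal{H}(0,\vec v)=\mathcal{L}(u(\vec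 v),\vec v)$). For $\vec y\in\Lambda_\sigma$ let $\mathbf{H}^{\vec y}(0)=\int_0^1\mathcal{H}(0,\dot{\vec y}(t))\,dt$ and $\langle u\rangle_{\vec y}=\int_0^1u(\dot{\vec y}(t))\,dt$. The efficiency is $$e_\sigma(\vec y)=-\frac{|\langle u\rangle_{\vec y}|^\sigma}{\mathbf{H}^{\vec y}(0)},$$ defined for those $\vec y\in\Lambda_\sigma$ with $\mathbf{H}^{\vec y}(0)\neq0$, and $\overline{e}_\sigma$ is the supremum of $e_\sigma(\vec y)$ over all $\vec y\in\Lambda_\sigma$ for which it is defined. The system is called mobilized if $\overline{e}_\sigma>0$, i.e. if there is $\vec y\in\Lambda_\sigma$ with $e_\sigma(\vec y)$ defined and positive. *)

theory Defs
  imports "HOL-Analysis.Analysis"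
begin

text \<open>Absolute continuity on a compact interval. The finite families of non-overlapping subintervals
  are the divisions \<^term>\<open>D\<close> of their own union; \<^term>\<open>Inf K\<close> and \<^term>\<open>Sup K\<close> are the endpoints
  of a member \<^term>\<open>K\<close>.\<close>

definition abs_continuous_on_interval :: "real \<Rightarrow> real \<Rightarrow> (real \<Rightarrow> real) \<Rightarrow> bool" where
  "abs_continuous_on_interval a b x \<longleftrightarrow>
     (\<forall>\<epsilon>>0. \<exists>\<delta>>0. \<forall>D. D division_of \<Union>D \<and> \<Union>D \<subseteq> {a..b} \<and> (\<Sum>K\<in>D. Sup K - Inf K) < \<delta> \<longrightarrow>
        (\<Sum>K\<in>D. \<bar>x (Sup K) - x (Inf K)\<bar>) < \<epsilon>)"

text \<open>A function on \<open>[0,1]\<close> is represented by a function on the reals of which only the restriction to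
  \<open>[0,1]\<close> matters: the derivative at an interior point depends on nothing else, and the two
  endpoints form a null set. The derivative exists almost everywhere by absolute continuity, so the
  arbitrary value of \<^const>\<open>deriv\<close> where it does not exist never enters an integral.\<close>

definition H_space :: "real \<Rightarrow> (real \<Rightarrow> real) set" where
  "H_space \<sigma> = {x. abs_continuous_on_interval 0 1 x \<and>
                    set_integrable lebesgue {0..1} (\<lambda>t. \<bar>deriv x t\<bar> powr \<sigma>)}"

definition Lambda_space :: "real \<Rightarrow> (real \<Rightarrow> real ^ 'n) set" where
  "Lambda_space \<sigma> = {y. (\<forall>i. (\<lambda>t. y t $ i) \<in> H_space \<sigma>) \<and> y 0 = y 1}"

definition velocity :: "(real \<Rightarrow> real ^ 'n) \<Rightarrow> real \<Rightarrow> real ^ 'n" where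
  "velocity y t = (\<chi> i. deriv (\<lambda>s. y s $ i) t)"

definition lagrangian :: "real \<Rightarrow> real ^ 'n \<Rightarrow> real \<Rightarrow> real ^ 'n \<Rightarrow> real" where
  "lagrangian \<sigma> m \<xi> v = (\<Sum>i\<in>UNIV. m $ i * \<bar>v $ i + \<xi>\<bar> powr \<sigma>)"

text \<open>The supremum is taken over a set that is bounded above, because for \<open>\<sigma> > 1\<close> and positive masses
  the Lagrangian grows superlinearly in \<open>\<xi>\<close>.\<close>

definition hamiltonian :: "real \<Rightarrow> real ^ 'n \<Rightarrow> real \<Rightarrow> real ^ 'n \<Rightarrow> real" where
  "hamiltonian \<sigma> m p v = (SUP \<xi>. p * \<xi> - lagrangian \<sigma> m \<xi> v)"

definition u_opt :: "real \<Rightarrow> real ^ 'n \<Rightarrow> real ^ 'n \<Rightarrow> real" where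
  "u_opt \<sigma> m v = deriv (\<lambda>p. hamiltonian \<sigma> m p v) 0"

definition mean_hamiltonian :: "real \<Rightarrow> real ^ 'n \<Rightarrow> (real \<Rightarrow> real ^ 'n) \<Rightarrow> real" where
  "mean_hamiltonian \<sigma> m y = (LINT t:{0..1}|lebesgue. hamiltonian \<sigma> m 0 (velocity y t))"

definition mean_u :: "real \<Rightarrow> real ^ 'n \<Rightarrow> (real \<Rightarrow> real ^ 'n) \<Rightarrow> real" where
  "mean_u \<sigma> m y = (LINT t:{0..1}|lebesgue. u_opt \<sigma> m (velocity y t))"

definition efficiency :: "real \<Rightarrow> real ^ 'n \<Rightarrow> (real \<Rightarrow> real ^ 'n) \<Rightarrow> real" where
  "efficiency \<sigma> m y = - (\<bar>mean_u \<sigma> m y\<bar> powr \<sigma> / mean_hamiltonian \<sigma> m y)"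

definition efficiency_domain :: "real \<Rightarrow> real ^ 'n \<Rightarrow> (real \<Rightarrow> real ^ 'n) set" where
  "efficiency_domain \<sigma> m = {y \<in> Lambda_space \<sigma>. mean_hamiltonian \<sigma> m y \<noteq> 0}"

text \<open>Taken in the extended reals, so that no boundedness or nonemptiness is presupposed.\<close>

definition max_efficiency :: "real \<Rightarrow> real ^ 'n \<Rightarrow> ereal" where
  "max_efficiency \<sigma> m = (SUP y\<in>efficiency_domain \<sigma> m. ereal (efficiency \<sigma> m y))"

definition mobilized :: "real \<Rightarrow> real ^ 'n \<Rightarrow> bool" where
  "mobilized \<sigma> m \<longleftrightarrow> max_efficiency \<sigma> m > 0"

lemma mobilized_iff:
  "mobilized \<sigma> m \<longleftrightarrow> (\<exists>y\<in>efficiency_domain \<sigma> m. efficiency \<sigma> m y > 0)"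
  by (simp add: mobilized_def max_efficiency_def less_SUP_iff)

end

theory Submission
  imports Defs
begin

text \<open>Put \<open>w = v + u(v)\<close> for the velocity \<open>v\<close> of a loop. Then \<open>w\<close> takes values in the closed cone of
  vectors for which \<open>0\<close> is the optimal shift, all coordinates of \<open>w\<close> have the same mean
  \<open>c = \<langle>u\<rangle>\<close>, and the efficiency is \<open>|c|^\<sigma>\<close> divided by the mean of \<open>cost w = \<Sum>i. m_i |w_i|^\<sigma>\<close>. By
  homogeneity \<open>c = 1\<close>, so one minimises the mean cost over the convex hull of the moments
  \<open>(1, w, cost w)\<close>. As the cost is superlinear, these moments become compact after division by
  \<open>1 + cost w\<close> and addition of one point at infinity. Hence the minimum is attained by a finite convex
  combination, that is by a piecewise linear loop; the mass at infinity can only be dropped. The minimum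
  exceeds \<open>1\<close> by strict Jensen, because \<open>(1,\<dots>,1)\<close> is not in the cone.\<close>

section \<open>Absolutely continuous functions\<close>

text \<open>A closed convex set contains the mean of every integrable family in it, so a convex cone
  would contain \<open>(c, ..., c)\<close>, and the strict inequality for \<open>vec 1\<close> would
  force \<open>c = 0\<close>. A mobilized system therefore has a cone that is not convex, and the
  minimum must be sought in a convex hull; alternating velocities in time is what makes convex
  combinations available to loops. The obstacle to compactness is mass that escapes to infinity with
  vanishing probability but positive cost. Since \<open>\<sigma> > 1\<close>, such mass carries no
  velocity in the limit, so one extra point accounts for it. After the division a mean cost
  \<open>J\<close> appears as first coordinate \<open>1 / (1 + J)\<close>, and minimising the cost
  becomes maximising a linear functional on a compact slice. Mobilization supplies a point of this
  slice with positive first coordinate, which keeps the maximum away from infinity. The condition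
  \<open>y 0 = y 1\<close> has to be read as zero mean velocity for paths that are merely absolutely
  continuous. This requires differentiability almost everywhere and the fundamental theorem of
  calculus.\<close>

definition division_variation :: "(real \<Rightarrow> real) \<Rightarrow> real set set \<Rightarrow> real" where
  "division_variation f D = (\<Sum>K\<in>D. \<bar>f (Sup K) - f (Inf K)\<bar>)"

lemma division_telescope:
  fixes f :: "real \<Rightarrow> real"
  assumes "a \<le> b" "D division_of {a..b}"
  shows "(\<Sum>K\<in>D. f (Sup K) - f (Inf K)) = f b - f a"
proof -
  \<comment> \<open>The value 0 on the empty set makes the increment additive on all intervals, as
    \<open>operative_real\<close> demands; members of a division are nonempty, so the sum is
    unaffected.\<close>
  let ?f = "(\<lambda>K::real set. if K = {} then 0 else f(interval_upperbound K) - f(interval_lowerbound K))"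
  interpret operative_real plus 0 ?f
    rewrites "comm_monoid_set.F (+) 0 = sum"
    by standard[1] (auto simp add: sum_def)
  have "sum ?f D = ?f {a..b}"
    using division[of D a b] assms(2) by simp
  moreover have "sum ?f D = (\<Sum>K\<in>D. f (Sup K) - f (Inf K))"
    using assms(2) by (intro sum.cong) auto
  ultimately show ?thesis
    using assms(1) by simp
qed

lemma division_variation_mono:
  "finite D \<Longrightarrow> C \<subseteq> D \<Longrightarrow> division_variation f C \<le> division_variation f D"
  unfolding division_variation_def by (rule sum_mono2) auto

text \<open>Refinements of different pieces have members with disjoint interiors, so only degenerate
  intervals can be shared, and those have increment 0. Forming the union as a set, which merges
  shared members, thus loses no variation.\<close>

lemma division_refine:
  fixes S :: "real set"
  assumes D: "D division_of S" and r: "\<And>L. L \<in> D \<Longrightarrow> r L division_of L"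
  shows "(\<Union>L\<in>D. r L) division_of S"
    and "division_variation f (\<Union>L\<in>D. r L) = (\<Sum>L\<in>D. division_variation f (r L))"
proof -
  have fin: "finite D" "\<And>L. L \<in> D \<Longrightarrow> finite (r L)"
    using D r by (auto simp: division_of_def)
  have disj: "interior K1 \<inter> interior K2 = {}"
    if "L1 \<in> D" "L2 \<in> D" "L1 \<noteq> L2" "K1 \<in> r L1" "K2 \<in> r L2" for L1 L2 K1 K2
  proof -
    have "K1 \<subseteq> L1" "K2 \<subseteq> L2"
      using that r by (auto simp: division_of_def)
    then show ?thesis
      using division_ofD(5)[OF D that(1-3)] interior_mono by blast
  qed
  show "(\<Union>L\<in>D. r L) division_of S"
  proof (rule division_ofI)
    show "finite (\<Union>L\<in>D. r L)" using fin by auto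
    show "\<Union>(\<Union>L\<in>D. r L) = S"
    proof -
      have "\<Union>(\<Union>L\<in>D. r L) = (\<Union>L\<in>D. \<Union>(r L))" by blast
      also have "\<dots> = \<Union>D" using division_ofD(6)[OF r] by simp
      also have "\<dots> = S" using D by auto
      finally show ?thesis .
    qed
    fix K assume "K \<in> (\<Union>L\<in>D. r L)"
    then obtain L where L: "L \<in> D" "K \<in> r L" by auto
    show "K \<noteq> {}" "\<exists>a b. K = cbox a b" using division_ofD(3,4)[OF r[OF L(1)] L(2)] by auto
    show "K \<subseteq> S" using division_ofD(2)[OF r[OF L(1)] L(2)] division_ofD(2)[OF D L(1)] by auto
    fix K' assume "K' \<in> (\<Union>L\<in>D. r L)" and ne: "K \<noteq> K'"
    then obtain L' where L': "L' \<in> D" "K' \<in> r L'" by auto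
    show "interior K \<inter> interior K' = {}"
    proof (cases "L = L'")
      case True
      then show ?thesis using division_ofD(5)[OF r[OF L(1)] L(2)] L' ne by auto
    next
      case False
      then show ?thesis using disj L L' by blast
    qed
  qed
  show "division_variation f (\<Union>L\<in>D. r L) = (\<Sum>L\<in>D. division_variation f (r L))"
  proof -
    let ?g = "\<lambda>K. \<bar>f (Sup K) - f (Inf K)\<bar>"
    have degenerate: "?g K = 0" if L: "L \<in> D" "K \<in> r L" and K: "interior K = {}" for L K
    proof -
      obtain c d where "K = cbox c d" "K \<noteq> {}"
        using division_ofD(3,4)[OF r[OF L(1)] L(2)] by blast
      moreover have "c = d"
        using calculation K by (cases "c < d") auto
      ultimately show ?thesis by simp
    qed
    have degen: "?g K = 0" if "L1 \<in> D" "L2 \<in> D" "r L1 \<noteq> r L2" "K \<in> r L1" "K \<in> r L2" for L1 L2 K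
    proof -
      have "interior K = {}" using disj[of L1 L2 K K] that by auto
      then show ?thesis using degenerate[OF that(1,4)] by simp
    qed
    have emp: "sum ?g (r L1) = 0" if "L1 \<in> D" "L2 \<in> D" "L1 \<noteq> L2" "r L1 = r L2" for L1 L2
    proof (rule sum.neutral, safe)
      fix K assume "K \<in> r L1"
      then have "interior K = {}" using disj[of L1 L2 K K] that by auto
      then show "?g K = 0" using degenerate[OF that(1) \<open>K \<in> r L1\<close>] by simp
    qed
    have "sum ?g (\<Union>(r ` D)) = (sum \<circ> sum) ?g (r ` D)"
    proof (rule sum.Union_comp)
      fix A1 A2 K assume "A1 \<in> r ` D" "A2 \<in> r ` D" "A1 \<noteq> A2" "K \<in> A1" "K \<in> A2"
      then show "?g K = 0" using degen by blast
    qed (use fin in auto)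
    also have "\<dots> = (\<Sum>L\<in>D. sum ?g (r L))"
      using emp fin by (subst comp_def, subst sum.reindex_nontrivial) auto
    finally show ?thesis by (simp add: division_variation_def)
  qed
qed

section \<open>Differentiability almost everywhere of functions of bounded variation\<close>

text \<open>The Vitali covering lemma picks countably many disjoint intervals whose fivefold
  enlargements cover \<open>E\<close>, whence the factor 5. The bound \<open>B\<close> for finite
  disjoint families passes to the countable union.\<close>

lemma interval_cover_measure:
  fixes E :: "real set" and P :: "real \<Rightarrow> real \<Rightarrow> bool"
  assumes cover: "\<And>x. x \<in> E \<Longrightarrow> \<exists>c d. P c d \<and> x \<in> {c..d}"
    and len: "\<And>c d. P c d \<Longrightarrow> c < d \<and> d - c \<le> R"
    and fam: "\<And>F. finite F \<Longrightarrow> (\<And>c d. (c, d) \<in> F \<Longrightarrow> P c d) \<Longrightarrow>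
        pairwise (\<lambda>p q. disjnt {fst p..snd p} {fst q..snd q}) F \<Longrightarrow> (\<Sum>(c, d)\<in>F. d - c) \<le> B"
  shows "\<exists>T. E \<subseteq> T \<and> T \<in> lmeasurable \<and> measure lebesgue T \<le> 5 * B"
proof -
  define K where "K = {p. P (fst p) (snd p)}"
  define a :: "real \<times> real \<Rightarrow> real" where "a p = (fst p + snd p) / 2" for p
  define r :: "real \<times> real \<Rightarrow> real" where "r p = (snd p - fst p) / 2" for p
  have cb: "cball (a p) (r p) = {fst p..snd p}" for p
    by (auto simp: a_def r_def cball_eq_atLeastAtMost field_simps)
  have "E \<subseteq> (\<Union>p\<in>K. cball (a p) (r p))"
    using cover unfolding cb K_def by fastforce
  moreover have pos: "0 < r p \<and> r p \<le> R / 2" if "p \<in> K" for p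
    using that len[of "fst p" "snd p"] by (auto simp: r_def K_def)
  ultimately obtain C where C: "countable C" "C \<subseteq> K"
    "pairwise (\<lambda>i j. disjnt (cball (a i) (r i)) (cball (a j) (r j))) C"
    "E \<subseteq> (\<Union>i\<in>C. cball (a i) (5 * r i))"
    by (rule Vitali_covering_lemma_cballs)
  have cb_measure: "measure lebesgue (cball x t) = 2 * t" if "0 < t" for x t :: real
    using that by (simp add: cball_eq_atLeastAtMost)
  let ?T = "\<Union>i\<in>C. cball (a i) (5 * r i)"
  have meas: "measure lebesgue (\<Union>i\<in>I. cball (a i) (5 * r i)) \<le> 5 * B" if I: "I \<subseteq> C" "finite I" for I
  proof -
    have "measure lebesgue (\<Union>i\<in>I. cball (a i) (5 * r i)) \<le> (\<Sum>i\<in>I. measure lebesgue (cball (a i) (5 * r i)))"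
      using I by (intro measure_UNION_le) auto
    also have "\<dots> = (\<Sum>i\<in>I. 5 * (snd i - fst i))"
    proof (rule sum.cong)
      fix i assume "i \<in> I"
      then have "i \<in> K" using I C(2) by auto
      then have "0 < r i" using pos by auto
      then show "measure lebesgue (cball (a i) (5 * r i)) = 5 * (snd i - fst i)"
        using cb_measure by (simp add: r_def)
    qed simp
    also have "\<dots> = 5 * (\<Sum>(c, d)\<in>I. d - c)"
      by (simp add: sum_distrib_left case_prod_beta)
    also have "(\<Sum>(c, d)\<in>I. d - c) \<le> B"
    proof (rule fam)
      show "pairwise (\<lambda>p q. disjnt {fst p..snd p} {fst q..snd q}) I"
        using pairwise_subset[OF C(3) I(1)] by (simp add: cb)
    qed (use I C(2) in \<open>auto simp: K_def\<close>)
    finally show ?thesis by simp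
  qed
  have "?T \<in> lmeasurable \<and> measure lebesgue ?T \<le> 5 * B"
    using C(1) meas
    by (metis (no_types, lifting) fmeasurable_UN_bound measure_UN_bound lmeasurable_cball)
  with C(4) show ?thesis by (intro exI[of _ ?T]) simp
qed

lemma closed_intervals_division:
  fixes F :: "(real \<times> real) set"
  assumes "finite F" "\<And>c d. (c, d) \<in> F \<Longrightarrow> c < d"
    and disj: "pairwise (\<lambda>p q. disjnt {fst p..snd p} {fst q..snd q}) F"
  shows "(\<lambda>(c, d). {c..d}) ` F division_of \<Union>((\<lambda>(c, d). {c..d}) ` F)"
    and "inj_on (\<lambda>(c, d). {c..d}) F"
proof -
  show "inj_on (\<lambda>(c, d). {c..d}) F"
    using assms(2) by (fastforce intro!: inj_onI)
  show "(\<lambda>(c, d). {c..d}) ` F division_of \<Union>((\<lambda>(c, d). {c..d}) ` F)"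
  proof (rule division_ofI)
    show "finite ((\<lambda>(c, d). {c..d}) ` F)" using assms(1) by simp
    fix K1 assume "K1 \<in> (\<lambda>(c, d). {c..d}) ` F"
    then obtain c d where K1: "(c, d) \<in> F" "K1 = {c..d}" by auto
    show "K1 \<noteq> {}" using K1 assms(2)[OF K1(1)] by auto
    show "\<exists>c d. K1 = cbox c d" using K1 by (auto simp flip: box_real)
    show "K1 \<subseteq> \<Union>((\<lambda>(c, d). {c..d}) ` F)" using K1 by blast
    fix K2 assume "K2 \<in> (\<lambda>(c, d). {c..d}) ` F" "K1 \<noteq> K2"
    then have "K1 \<inter> K2 = {}"
      using disj K1 by (fastforce simp: pairwise_def disjnt_def)
    then show "interior K1 \<inter> interior K2 = {}"
      using interior_subset by blast
  qed simp
qed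

text \<open>Austin's argument: refining an almost maximal division by disjoint intervals on which the
  increment has the opposite sign would increase the variation by twice the increments.\<close>

lemma negligible_opposite_slopes:
  fixes f :: "real \<Rightarrow> real"
  assumes ab: "a < b" and \<epsilon>: "\<epsilon> > 0"
    and bound: "\<And>D. D division_of {a..b} \<Longrightarrow> division_variation f D \<le> B"
  shows "negligible {x \<in> {a<..<b}. (\<exists>\<^sub>F h in at 0. (f (x + h) - f x) / h > \<epsilon>) \<and>
                                   (\<exists>\<^sub>F h in at 0. (f (x + h) - f x) / h < - \<epsilon>)}"
    (is "negligible ?E")
  unfolding negligible_outer_le
proof (intro allI impI)
  fix e :: real assume e: "e > 0"
  define V where "V = Sup {division_variation f D |D. D division_of {a..b}}"
  let ?S = "{division_variation f D |D. D division_of {a..b}}"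
  have "{{a..b}} division_of {a..b}"
    using division_of_self[of a b] ab by auto
  then have ne: "?S \<noteq> {}" by blast
  have bdd: "bdd_above ?S" using bound by (auto intro!: bdd_aboveI)
  have V: "division_variation f D \<le> V" if "D division_of {a..b}" for D
    unfolding V_def using that bdd by (intro cSup_upper) auto
  \<comment> \<open>The variation cannot grow by more than \<open>\<eta>\<close>, while the
    refinement gains \<open>2 * \<epsilon>\<close> times the total length; this length is then at
    most \<open>e / 5\<close>, which the covering lemma turns into \<open>e\<close>.\<close>
  define \<eta> where "\<eta> = 2 * \<epsilon> * (e / 5)"
  have "\<eta> > 0" using e \<epsilon> by (simp add: \<eta>_def)
  then obtain D where D: "D division_of {a..b}" and DV: "division_variation f D > V - \<eta>"
    using less_cSup_iff[OF ne bdd, of "V - \<eta>"] unfolding V_def by auto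
  have finD: "finite D" using D by auto
  \<comment> \<open>Without the endpoints of the almost maximal division every point lies in the
    interior of its member, so short intervals around it stay there.\<close>
  define X where "X = (\<Union>L\<in>D. {Inf L, Sup L})"
  have "finite X" using finD by (simp add: X_def)
  \<comment> \<open>Containment in the interior, and not just in \<open>L\<close>, assigns each
    interval to one member only; the disjointness of the families \<open>G L\<close> below rests on
    this.\<close>
  define Q where "Q L c d \<longleftrightarrow> c < d \<and> {c..d} \<subseteq> interior L \<and> \<epsilon> * (d - c) \<le> \<bar>f d - f c\<bar> \<and>
      (if f (Sup L) - f (Inf L) \<ge> 0 then f d - f c \<le> 0 else f d - f c \<ge> 0)" for L c d
  have "\<exists>T. ?E - X \<subseteq> T \<and> T \<in> lmeasurable \<and> measure lebesgue T \<le> 5 * (e / 5)"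
  proof (rule interval_cover_measure[where P = "\<lambda>c d. \<exists>L\<in>D. Q L c d" and R = "b - a"])
    fix x assume x: "x \<in> ?E - X"
    then obtain L where L: "L \<in> D" "x \<in> L"
      using division_ofD(6)[OF D] by (metis (no_types, lifting) DiffD1 UnionE atLeastAtMost_iff
          greaterThanLessThan_iff less_imp_le mem_Collect_eq)
    obtain u v where uv: "L = {u..v}" using division_ofD(4)[OF D L(1)] by auto
    have "u \<le> v" using L uv by auto
    then have "u \<in> X" "v \<in> X" using L uv by (auto simp: X_def intro!: bexI[of _ L])
    then have xuv: "u < x" "x < v" using x L uv by (auto simp: less_le)
    have near: "\<forall>\<^sub>F h in at 0. {min x (x + h)..max x (x + h)} \<subseteq> {u<..<v} \<and> h \<noteq> 0"
    proof -
      have "\<forall>\<^sub>F h in at 0. u < x + h \<and> x + h < v"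
        using xuv by (intro eventually_conj order_tendstoD[where y = x]) (auto intro!: tendsto_eq_intros)
      moreover have "\<forall>\<^sub>F h in at 0. h \<noteq> (0::real)" by (simp add: eventually_neq_at_within)
      ultimately show ?thesis by eventually_elim (use xuv in auto)
    qed
    \<comment> \<open>Written with \<open>min\<close> and \<open>max\<close>, both signs of
      \<open>h\<close> are treated at once.\<close>
    have sl: "f (max x (x + h)) - f (min x (x + h)) = (f (x + h) - f x) / h * \<bar>h\<bar>"
       "max x (x + h) - min x (x + h) = \<bar>h\<bar>" if "h \<noteq> 0" for h
      using that by (auto simp: max_def min_def field_simps)
    show "\<exists>c d. (\<exists>L\<in>D. Q L c d) \<and> x \<in> {c..d}"
    proof (cases "f (Sup L) - f (Inf L) \<ge> 0")
      case True
      have "\<exists>\<^sub>F h in at 0. (f (x + h) - f x) / h < - \<epsilon>" using x by auto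
      then obtain h where h: "(f (x + h) - f x) / h < - \<epsilon>"
        "{min x (x + h)..max x (x + h)} \<subseteq> {u<..<v}" "h \<noteq> 0"
        using near frequently_ex[OF frequently_eventually_conj] by blast
      have "(f (x + h) - f x) / h * \<bar>h\<bar> \<le> - \<epsilon> * \<bar>h\<bar>"
        using h by (intro mult_right_mono) auto
      moreover have "\<epsilon> * \<bar>h\<bar> > 0" using h \<epsilon> by simp
      ultimately have "\<epsilon> * \<bar>h\<bar> \<le> \<bar>(f (x + h) - f x) / h * \<bar>h\<bar>\<bar> \<and> (f (x + h) - f x) / h * \<bar>h\<bar> \<le> 0"
        by linarith
      moreover have "min x (x + h) < max x (x + h)" using h by (auto simp: min_def max_def)
      moreover have "interior L = {u<..<v}" by (simp add: uv)
      ultimately have "Q L (min x (x + h)) (max x (x + h))"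
        using h(2) True unfolding Q_def sl[OF h(3)] by presburger
      then show ?thesis using L by (intro exI[of _ "min x (x + h)"] exI[of _ "max x (x + h)"]) auto
    next
      case False
      have "\<exists>\<^sub>F h in at 0. (f (x + h) - f x) / h > \<epsilon>" using x by auto
      then obtain h where h: "(f (x + h) - f x) / h > \<epsilon>"
        "{min x (x + h)..max x (x + h)} \<subseteq> {u<..<v}" "h \<noteq> 0"
        using near frequently_ex[OF frequently_eventually_conj] by blast
      have "(f (x + h) - f x) / h * \<bar>h\<bar> \<ge> \<epsilon> * \<bar>h\<bar>"
        using h by (intro mult_right_mono) auto
      moreover have "\<epsilon> * \<bar>h\<bar> > 0" using h \<epsilon> by simp
      ultimately have "\<epsilon> * \<bar>h\<bar> \<le> \<bar>(f (x + h) - f x) / h * \<bar>h\<bar>\<bar> \<and> (f (x + h) - f x) / h * \<bar>h\<bar> \<ge> 0"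
        by linarith
      moreover have "min x (x + h) < max x (x + h)" using h by (auto simp: min_def max_def)
      moreover have "interior L = {u<..<v}" by (simp add: uv)
      ultimately have "Q L (min x (x + h)) (max x (x + h))"
        using h(2) False unfolding Q_def sl[OF h(3)] by presburger
      then show ?thesis using L by (intro exI[of _ "min x (x + h)"] exI[of _ "max x (x + h)"]) auto
    qed
  next
    fix c d assume "\<exists>L\<in>D. Q L c d"
    then obtain L where L: "L \<in> D" "c < d" "{c..d} \<subseteq> L"
      using interior_subset unfolding Q_def by blast
    then have "{c..d} \<subseteq> {a..b}" using D by blast
    then show "c < d \<and> d - c \<le> b - a" using L by auto
  next
    fix F :: "(real \<times> real) set"
    assume finF: "finite F" and FQ: "\<And>c d. (c, d) \<in> F \<Longrightarrow> \<exists>L\<in>D. Q L c d"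
      and disj: "pairwise (\<lambda>p q. disjnt {fst p..snd p} {fst q..snd q}) F"
    define G where "G L = {p \<in> F. Q L (fst p) (snd p)}" for L
    let ?I = "\<lambda>(c, d). {c..d::real}"
    have "\<exists>r. r division_of L \<and> division_variation f r \<ge>
        \<bar>f (Sup L) - f (Inf L)\<bar> + 2 * \<epsilon> * (\<Sum>(c, d)\<in>G L. d - c)" if L: "L \<in> D" for L
    proof -
      obtain u v where uv: "L = {u..v}" "u \<le> v"
        using division_ofD(3,4)[OF D L] by auto
      have G: "finite (G L)" "\<And>c d. (c, d) \<in> G L \<Longrightarrow> c < d"
        "pairwise (\<lambda>p q. disjnt {fst p..snd p} {fst q..snd q}) (G L)"
        using finF pairwise_subset[OF disj] by (auto simp: G_def Q_def)
      let ?C = "?I ` G L"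
      note C = closed_intervals_division[OF G]
      have "\<Union>?C \<subseteq> L" using interior_subset by (fastforce simp: G_def Q_def)
      moreover have "{L} division_of L" using uv division_of_self[of u v] by auto
      ultimately obtain r where r: "?C \<subseteq> r" "r division_of L"
        using partial_division_extend[OF C(1)] by metis
      have finr: "finite r" using r by auto
      let ?d = "\<lambda>K. f (Sup K) - f (Inf K)"
      have tel: "(\<Sum>K\<in>r. ?d K) = f v - f u"
        using division_telescope[of u v r] r uv by simp
      have split: "sum g r = sum g ?C + sum g (r - ?C)" for g :: "real set \<Rightarrow> real"
        using sum.subset_diff[OF r(1) finr, of g] by simp
      have SI: "Sup L = v" "Inf L = u" using uv by auto
      have sgn: "(if f v - f u \<ge> 0 then ?d K \<le> 0 else ?d K \<ge> 0)" if "K \<in> ?C" for K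
        using that unfolding G_def Q_def SI by (auto split: if_splits)
      \<comment> \<open>Subtracting increments whose sign opposes the total enlarges its absolute
        value. The rest of \<open>r\<close> has to make up for that, and \<open>?C\<close>
        contributes its own variation once more, hence the factor 2 below.\<close>
      have dC: "\<bar>f v - f u - sum ?d ?C\<bar> = \<bar>f v - f u\<bar> + (\<Sum>K\<in>?C. \<bar>?d K\<bar>)"
      proof (cases "f v - f u \<ge> 0")
        case True
        then have "(\<Sum>K\<in>?C. \<bar>?d K\<bar>) = - sum ?d ?C"
          using sgn by (subst sum_negf[symmetric], intro sum.cong) auto
        moreover have "sum ?d ?C \<le> 0" using sgn True by (intro sum_nonpos) auto
        ultimately show ?thesis using True by linarith
      next
        case False
        then have "(\<Sum>K\<in>?C. \<bar>?d K\<bar>) = (\<Sum>K\<in>?C. ?d K)"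
          using sgn by (intro sum.cong) auto
        moreover have "sum ?d ?C \<ge> 0" using sgn False by (intro sum_nonneg) auto
        ultimately show ?thesis using False by simp
      qed
      have "\<bar>f v - f u - sum ?d ?C\<bar> = \<bar>sum ?d (r - ?C)\<bar>"
        using tel split[of ?d] by simp
      also have "\<dots> \<le> (\<Sum>K\<in>r - ?C. \<bar>?d K\<bar>)" by (rule sum_abs)
      finally have "division_variation f r \<ge> \<bar>f v - f u\<bar> + 2 * (\<Sum>K\<in>?C. \<bar>?d K\<bar>)"
        using dC split[of "\<lambda>K. \<bar>?d K\<bar>"] by (simp add: division_variation_def)
      moreover have "\<epsilon> * (\<Sum>(c, d)\<in>G L. d - c) \<le> (\<Sum>K\<in>?C. \<bar>?d K\<bar>)"
      proof -
        have "(\<Sum>K\<in>?C. \<bar>?d K\<bar>) = (\<Sum>p\<in>G L. \<bar>?d (?I p)\<bar>)"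
          using sum.reindex[OF C(2), of "\<lambda>K. \<bar>?d K\<bar>"] by (simp add: comp_def)
        also have "\<dots> \<ge> (\<Sum>p\<in>G L. \<epsilon> * (snd p - fst p))"
        proof (rule sum_mono)
          fix p assume "p \<in> G L"
          then have "Q L (fst p) (snd p)" by (simp add: G_def)
          then show "\<epsilon> * (snd p - fst p) \<le> \<bar>?d (?I p)\<bar>"
            by (simp add: Q_def case_prod_beta)
        qed
        finally show ?thesis by (simp add: sum_distrib_left case_prod_beta)
      qed
      ultimately show ?thesis using r(2) unfolding SI by (intro exI[of _ r]) linarith
    qed
    then obtain r where r: "\<And>L. L \<in> D \<Longrightarrow> r L division_of L"
      "\<And>L. L \<in> D \<Longrightarrow> division_variation f (r L) \<ge>
        \<bar>f (Sup L) - f (Inf L)\<bar> + 2 * \<epsilon> * (\<Sum>(c, d)\<in>G L. d - c)"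
      by metis
    have "V \<ge> (\<Sum>L\<in>D. division_variation f (r L))"
      using V division_refine[OF D r(1)] by metis
    also have "(\<Sum>L\<in>D. division_variation f (r L)) \<ge>
        (\<Sum>L\<in>D. \<bar>f (Sup L) - f (Inf L)\<bar> + 2 * \<epsilon> * (\<Sum>(c, d)\<in>G L. d - c))"
      using r(2) by (intro sum_mono)
    also have "(\<Sum>L\<in>D. \<bar>f (Sup L) - f (Inf L)\<bar> + 2 * \<epsilon> * (\<Sum>(c, d)\<in>G L. d - c)) =
        division_variation f D + 2 * \<epsilon> * (\<Sum>L\<in>D. \<Sum>(c, d)\<in>G L. d - c)"
      by (simp add: sum.distrib sum_distrib_left division_variation_def)
    also have "(\<Sum>L\<in>D. \<Sum>(c, d)\<in>G L. d - c) = (\<Sum>(c, d)\<in>(\<Union>L\<in>D. G L). d - c)"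
    proof (rule sum.UNION_disjoint[symmetric, OF finD])
      show "\<forall>L\<in>D. finite (G L)" using finF by (simp add: G_def)
      show "\<forall>L\<in>D. \<forall>L'\<in>D. L \<noteq> L' \<longrightarrow> G L \<inter> G L' = {}"
      proof (intro ballI impI equals0I)
        fix L L' p assume LL: "L \<in> D" "L' \<in> D" "L \<noteq> L'" and "p \<in> G L \<inter> G L'"
        then have "fst p \<in> {fst p..snd p}" "{fst p..snd p} \<subseteq> interior L" "{fst p..snd p} \<subseteq> interior L'"
          unfolding G_def Q_def by (simp_all add: less_imp_le)
        then show False using division_ofD(5)[OF D LL] by blast
      qed
    qed
    also have "(\<Union>L\<in>D. G L) = F" using FQ by (fastforce simp: G_def)
    finally have "2 * \<epsilon> * (\<Sum>(c, d)\<in>F. d - c) \<le> \<eta>" using DV by linarith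
    then show "(\<Sum>(c, d)\<in>F. d - c) \<le> e / 5" using \<epsilon> by (simp add: \<eta>_def)
  qed
  then obtain T where T: "?E - X \<subseteq> T" "T \<in> lmeasurable" "measure lebesgue T \<le> e" by auto
  have X: "negligible X" using \<open>finite X\<close> by (rule negligible_finite)
  then have "X \<in> lmeasurable" "measure lebesgue X = 0"
    by (simp_all add: negligible_imp_measurable negligible_imp_measure0)
  then have "T \<union> X \<in> lmeasurable" "measure lebesgue (T \<union> X) \<le> e"
    using T measure_Un_le[of T lebesgue X] by (auto simp: fmeasurableD)
  then show "\<exists>T. ?E \<subseteq> T \<and> T \<in> lmeasurable \<and> measure lebesgue T \<le> e"
    using T(1) by blast
qed

text \<open>Disjoint intervals on which the slope is at least \<open>M\<close> in absolute value
  have total length at most \<open>B / M\<close>, which is small for large \<open>M\<close>;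
  covering costs a factor 5.\<close>

lemma negligible_infinite_slopes:
  fixes f :: "real \<Rightarrow> real"
  assumes ab: "a < b"
    and bound: "\<And>D. D division_of {a..b} \<Longrightarrow> division_variation f D \<le> B"
  shows "negligible {x \<in> {a<..<b}. \<forall>M. \<exists>\<^sub>F h in at 0. \<bar>(f (x + h) - f x) / h\<bar> > M}"
    (is "negligible ?E")
  unfolding negligible_outer_le
proof (intro allI impI)
  fix e :: real assume e: "e > 0"
  \<comment> \<open>Chosen so that \<open>M * (e / 5)\<close> is \<open>\<bar>B\<bar> + 1\<close>;
    the summand 1 keeps \<open>M\<close> positive.\<close>
  define M where "M = 5 * (\<bar>B\<bar> + 1) / e"
  have M: "M > 0" using e by (simp add: M_def)
  define Q where "Q c d \<longleftrightarrow> c < d \<and> {c..d} \<subseteq> {a..b} \<and> M * (d - c) \<le> \<bar>f d - f c\<bar>" for c d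
  have "\<exists>T. ?E \<subseteq> T \<and> T \<in> lmeasurable \<and> measure lebesgue T \<le> 5 * (e / 5)"
  proof (rule interval_cover_measure[where P = Q and R = "b - a"])
    fix x assume x: "x \<in> ?E"
    have near: "\<forall>\<^sub>F h in at 0. {min x (x + h)..max x (x + h)} \<subseteq> {a<..<b} \<and> h \<noteq> 0"
    proof -
      have "\<forall>\<^sub>F h in at 0. a < x + h \<and> x + h < b"
        using x by (intro eventually_conj order_tendstoD[where y = x]) (auto intro!: tendsto_eq_intros)
      moreover have "\<forall>\<^sub>F h in at 0. h \<noteq> (0::real)" by (simp add: eventually_neq_at_within)
      ultimately show ?thesis by eventually_elim (use x in auto)
    qed
    have sl: "\<bar>f (max x (x + h)) - f (min x (x + h))\<bar> = \<bar>(f (x + h) - f x) / h\<bar> * \<bar>h\<bar>"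
       "max x (x + h) - min x (x + h) = \<bar>h\<bar>" if "h \<noteq> 0" for h
      using that by (auto simp: max_def min_def field_simps)
    have "\<exists>\<^sub>F h in at 0. \<bar>(f (x + h) - f x) / h\<bar> > M" using x by auto
    then obtain h where h: "\<bar>(f (x + h) - f x) / h\<bar> > M"
      "{min x (x + h)..max x (x + h)} \<subseteq> {a<..<b}" "h \<noteq> 0"
      using near frequently_ex[OF frequently_eventually_conj] by blast
    have "\<bar>(f (x + h) - f x) / h\<bar> * \<bar>h\<bar> \<ge> M * \<bar>h\<bar>"
      using h by (intro mult_right_mono) auto
    then have "Q (min x (x + h)) (max x (x + h))"
      using h unfolding Q_def sl[OF h(3)] by (auto simp: min_def max_def subset_iff)
    then show "\<exists>c d. Q c d \<and> x \<in> {c..d}"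
      by (intro exI[of _ "min x (x + h)"] exI[of _ "max x (x + h)"]) auto
  next
    fix c d assume "Q c d"
    then show "c < d \<and> d - c \<le> b - a" by (auto simp: Q_def)
  next
    fix F :: "(real \<times> real) set"
    assume finF: "finite F" and FQ: "\<And>c d. (c, d) \<in> F \<Longrightarrow> Q c d"
      and disj: "pairwise (\<lambda>p q. disjnt {fst p..snd p} {fst q..snd q}) F"
    have lt: "\<And>c d. (c, d) \<in> F \<Longrightarrow> c < d" using FQ by (simp add: Q_def)
    let ?I = "\<lambda>(c, d). {c..d::real}"
    note C = closed_intervals_division[OF finF lt disj]
    have "\<Union>(?I ` F) \<subseteq> {a..b}" using FQ by (fastforce simp: Q_def)
    moreover have "{{a..b}} division_of {a..b}" using division_of_self[of a b] ab by auto
    ultimately obtain r where r: "?I ` F \<subseteq> r" "r division_of {a..b}"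
      using partial_division_extend[OF C(1)] by metis
    have "M * (\<Sum>(c, d)\<in>F. d - c) = (\<Sum>p\<in>F. M * (snd p - fst p))"
      by (simp add: sum_distrib_left case_prod_beta)
    also have "\<dots> \<le> (\<Sum>p\<in>F. \<bar>f (snd p) - f (fst p)\<bar>)"
      using FQ by (intro sum_mono) (auto simp: Q_def)
    also have "\<dots> = (\<Sum>p\<in>F. \<bar>f (Sup (?I p)) - f (Inf (?I p))\<bar>)"
      using lt by (intro sum.cong) (auto simp: less_imp_le)
    also have "\<dots> = division_variation f (?I ` F)"
      using sum.reindex[OF C(2), of "\<lambda>K. \<bar>f (Sup K) - f (Inf K)\<bar>"]
      by (simp add: division_variation_def comp_def)
    also have "\<dots> \<le> division_variation f r"
      using r by (intro division_variation_mono) auto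
    also have "\<dots> \<le> B" using bound r by simp
    also have "\<dots> \<le> M * (e / 5)" using e by (simp add: M_def)
    finally show "(\<Sum>(c, d)\<in>F. d - c) \<le> e / 5"
      using M by (rule mult_left_le_imp_le)
  qed
  then show "\<exists>T. ?E \<subseteq> T \<and> T \<in> lmeasurable \<and> measure lebesgue T \<le> e" by simp
qed

lemma division_variation_minus_linear:
  fixes f :: "real \<Rightarrow> real"
  assumes "a \<le> b" and D: "D division_of {a..b}"
  shows "division_variation (\<lambda>x. f x - c * x) D \<le> division_variation f D + \<bar>c\<bar> * (b - a)"
proof -
  have len: "Inf K \<le> Sup K" if "K \<in> D" for K
    using division_ofD(3,4)[OF D that] by auto
  have "division_variation (\<lambda>x. f x - c * x) D
      \<le> (\<Sum>K\<in>D. \<bar>f (Sup K) - f (Inf K)\<bar> + \<bar>c\<bar> * (Sup K - Inf K))"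
    unfolding division_variation_def
  proof (rule sum_mono)
    fix K assume "K \<in> D"
    have "f (Sup K) - c * Sup K - (f (Inf K) - c * Inf K) =
        (f (Sup K) - f (Inf K)) - c * (Sup K - Inf K)" by algebra
    also have "\<bar>\<dots>\<bar> \<le> \<bar>f (Sup K) - f (Inf K)\<bar> + \<bar>c * (Sup K - Inf K)\<bar>"
      by (rule abs_triangle_ineq4)
    finally show "\<bar>f (Sup K) - c * Sup K - (f (Inf K) - c * Inf K)\<bar> \<le>
        \<bar>f (Sup K) - f (Inf K)\<bar> + \<bar>c\<bar> * (Sup K - Inf K)"
      using len[OF \<open>K \<in> D\<close>] by (simp add: abs_mult)
  qed
  also have "\<dots> = division_variation f D + \<bar>c\<bar> * (\<Sum>K\<in>D. Sup K - Inf K)"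
    by (simp add: sum.distrib sum_distrib_left division_variation_def)
  also have "(\<Sum>K\<in>D. Sup K - Inf K) = b - a"
    using division_telescope[OF assms, of "\<lambda>x. x"] by simp
  finally show ?thesis .
qed

text \<open>Subtracting the line of slope \<open>(p + q) / 2\<close> moves the thresholds to
  \<open>(q - p) / 2\<close> and its negative, and changes the variation by a bounded amount. This
  reduces the claim to slopes of opposite sign.\<close>

lemma negligible_separated_slopes:
  fixes f :: "real \<Rightarrow> real"
  assumes ab: "a < b" and pq: "p < q"
    and bound: "\<And>D. D division_of {a..b} \<Longrightarrow> division_variation f D \<le> B"
  shows "negligible {x \<in> {a<..<b}. (\<exists>\<^sub>F h in at 0. (f (x + h) - f x) / h > q) \<and>
                                   (\<exists>\<^sub>F h in at 0. (f (x + h) - f x) / h < p)}"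
    (is "negligible ?E")
proof -
  let ?c = "(p + q) / 2"
  let ?\<epsilon> = "(q - p) / 2"
  let ?g = "\<lambda>x. f x - ?c * x"
  have q: "(?g (x + h) - ?g x) / h = (f (x + h) - f x) / h - ?c" if "h \<noteq> 0" for x h
    using that by (simp add: field_simps)
  have up: "\<exists>\<^sub>F h in at 0. (?g (x + h) - ?g x) / h > ?\<epsilon>"
    if "\<exists>\<^sub>F h in at 0. (f (x + h) - f x) / h > q" for x
  proof -
    have "\<exists>\<^sub>F h in at 0. (f (x + h) - f x) / h > q \<and> h \<noteq> 0"
      using frequently_eventually_conj[OF that eventually_neq_at_within[of 0 0 UNIV]]
      by (simp add: conj_commute)
    then show ?thesis
    proof (rule frequently_elim1)
      fix h assume "(f (x + h) - f x) / h > q \<and> h \<noteq> 0"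
      then show "(?g (x + h) - ?g x) / h > ?\<epsilon>" using q[of h x] by argo
    qed
  qed
  have down: "\<exists>\<^sub>F h in at 0. (?g (x + h) - ?g x) / h < - ?\<epsilon>"
    if "\<exists>\<^sub>F h in at 0. (f (x + h) - f x) / h < p" for x
  proof -
    have "\<exists>\<^sub>F h in at 0. (f (x + h) - f x) / h < p \<and> h \<noteq> 0"
      using frequently_eventually_conj[OF that eventually_neq_at_within[of 0 0 UNIV]]
      by (simp add: conj_commute)
    then show ?thesis
    proof (rule frequently_elim1)
      fix h assume "(f (x + h) - f x) / h < p \<and> h \<noteq> 0"
      then show "(?g (x + h) - ?g x) / h < - ?\<epsilon>" using q[of h x] by argo
    qed
  qed
  have "negligible {x \<in> {a<..<b}. (\<exists>\<^sub>F h in at 0. (?g (x + h) - ?g x) / h > ?\<epsilon>) \<and>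
                                   (\<exists>\<^sub>F h in at 0. (?g (x + h) - ?g x) / h < - ?\<epsilon>)}"
  proof (rule negligible_opposite_slopes[OF ab])
    fix D assume D: "D division_of {a..b}"
    show "division_variation ?g D \<le> B + \<bar>?c\<bar> * (b - a)"
      using division_variation_minus_linear[OF _ D, of f ?c] ab bound[OF D] by linarith
  qed (use pq in simp)
  then show ?thesis
    by (rule negligible_subset) (use up down in blast)
qed

text \<open>\<open>Sup S\<close> is the upper limit of the difference quotients, finite by
  \<open>bdd\<close>. A smaller lower limit would leave room for rationals \<open>p < q\<close> in
  between, which \<open>sep\<close> forbids, so the quotients converge.\<close>

lemma differentiable_from_slopes:
  fixes f :: "real \<Rightarrow> real"
  assumes bdd: "\<forall>\<^sub>F h in at 0. \<bar>(f (x + h) - f x) / h\<bar> \<le> M"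
    and sep: "\<And>p q. p \<in> \<rat> \<Longrightarrow> q \<in> \<rat> \<Longrightarrow> p < q \<Longrightarrow> \<exists>\<^sub>F h in at 0. (f (x + h) - f x) / h > q \<Longrightarrow>
           \<exists>\<^sub>F h in at 0. (f (x + h) - f x) / h < p \<Longrightarrow> False"
  shows "f differentiable at x"
proof -
  let ?Q = "\<lambda>h. (f (x + h) - f x) / h"
  define S where "S = {c. \<exists>\<^sub>F h in at 0. ?Q h > c}"
  have "\<forall>\<^sub>F h in at 0. ?Q h > - M - 1" using bdd by eventually_elim linarith
  then have "- M - 1 \<in> S" unfolding S_def by (simp add: eventually_frequently)
  then have ne: "S \<noteq> {}" by auto
  have "c \<le> M" if "c \<in> S" for c
  proof (rule ccontr)
    assume "\<not> c \<le> M"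
    then have "\<forall>\<^sub>F h in at 0. \<not> ?Q h > c" using bdd by (elim eventually_mono) linarith
    then show False using that by (simp add: S_def frequently_def)
  qed
  then have bd: "bdd_above S" by (rule bdd_aboveI)
  have "(?Q \<longlongrightarrow> Sup S) (at 0)"
  proof (rule order_tendstoI)
    fix u assume "u > Sup S"
    then obtain v where v: "Sup S < v" "v < u" using dense by blast
    then have "v \<notin> S" using cSup_upper[OF _ bd] by force
    then have "\<forall>\<^sub>F h in at 0. \<not> ?Q h > v" by (simp add: S_def frequently_def)
    then show "\<forall>\<^sub>F h in at 0. ?Q h < u" by eventually_elim (use v in linarith)
  next
    fix u assume u: "u < Sup S"
    then obtain p where p: "p \<in> \<rat>" "u < p" "p < Sup S" using Rats_dense_in_real by blast
    then obtain q where q: "q \<in> \<rat>" "p < q" "q < Sup S" using Rats_dense_in_real by blast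
    then obtain c where c: "c \<in> S" "q < c" using less_cSup_iff[OF ne bd] by blast
    have "\<exists>\<^sub>F h in at 0. ?Q h > q"
      using c unfolding S_def by (auto elim: frequently_elim1)
    then have "\<not> (\<exists>\<^sub>F h in at 0. ?Q h < p)" using sep p q by blast
    then have "\<forall>\<^sub>F h in at 0. \<not> ?Q h < p" by (simp add: frequently_def)
    then show "\<forall>\<^sub>F h in at 0. u < ?Q h" by eventually_elim (use p in linarith)
  qed
  then have "DERIV f x :> Sup S" by (simp add: DERIV_def)
  then show ?thesis using real_differentiable_def by blast
qed

text \<open>Failure of differentiability means unbounded slopes or slopes separated by a rational
  pair, and there are countably many such pairs.\<close>

lemma bounded_variation_ae_differentiable:
  fixes f :: "real \<Rightarrow> real"
  assumes ab: "a < b"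
    and bound: "\<And>D. D division_of {a..b} \<Longrightarrow> division_variation f D \<le> B"
  shows "negligible {x \<in> {a<..<b}. \<not> f differentiable at x}"
proof -
  let ?I = "{x \<in> {a<..<b}. \<forall>M. \<exists>\<^sub>F h in at 0. \<bar>(f (x + h) - f x) / h\<bar> > M}"
  let ?E = "\<lambda>(p, q). {x \<in> {a<..<b}. (\<exists>\<^sub>F h in at 0. (f (x + h) - f x) / h > q) \<and>
                                   (\<exists>\<^sub>F h in at 0. (f (x + h) - f x) / h < p)}"
  let ?R = "{(p, q) \<in> \<rat> \<times> \<rat>. p < (q::real)}"
  have "countable ?R"
    by (rule countable_subset[of _ "\<rat> \<times> \<rat>"]) (auto intro: countable_rat)
  then have "negligible (\<Union>(?E ` ?R))"
    using negligible_separated_slopes[OF ab _ bound] by (intro negligible_countable_Union) auto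
  moreover have "negligible ?I"
    using negligible_infinite_slopes[OF ab bound] by blast
  ultimately have "negligible (?I \<union> \<Union>(?E ` ?R))" by simp
  then show ?thesis
  proof (rule negligible_subset, intro subsetI)
    fix x assume "x \<in> {x \<in> {a<..<b}. \<not> f differentiable at x}"
    then have x: "x \<in> {a<..<b}" "\<not> f differentiable at x" by auto
    show "x \<in> ?I \<union> \<Union>(?E ` ?R)"
    proof (rule ccontr)
      assume nx: "x \<notin> ?I \<union> \<Union>(?E ` ?R)"
      then obtain M where "\<not> (\<exists>\<^sub>F h in at 0. \<bar>(f (x + h) - f x) / h\<bar> > M)" using x nx by auto
      then have "\<forall>\<^sub>F h in at 0. \<bar>(f (x + h) - f x) / h\<bar> \<le> M" by (simp add: frequently_def not_less)
      moreover have "False" if "p \<in> \<rat>" "q \<in> \<rat>" "p < q" "\<exists>\<^sub>F h in at 0. (f (x + h) - f x) / h > q"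
        "\<exists>\<^sub>F h in at 0. (f (x + h) - f x) / h < p" for p q
      proof -
        have "x \<in> ?E (p, q)" "(p, q) \<in> ?R" using x that by auto
        then show False using nx by blast
      qed
      ultimately have "f differentiable at x" by (rule differentiable_from_slopes)
      then show False using x by simp
    qed
  qed
qed

section \<open>The fundamental theorem of calculus for absolutely continuous functions\<close>

lemma abs_continuousE:
  assumes "abs_continuous_on_interval a b f" "\<epsilon> > 0"
  obtains \<delta> where "\<delta> > 0"
    "\<And>D. D division_of \<Union>D \<Longrightarrow> \<Union>D \<subseteq> {a..b} \<Longrightarrow> (\<Sum>K\<in>D. Sup K - Inf K) < \<delta> \<Longrightarrow>
        division_variation f D < \<epsilon>"
proof -
  obtain \<delta> where "\<delta> > 0"
    "\<forall>D. D division_of \<Union>D \<and> \<Union>D \<subseteq> {a..b} \<and> (\<Sum>K\<in>D. Sup K - Inf K) < \<delta> \<longrightarrow>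
        (\<Sum>K\<in>D. \<bar>f (Sup K) - f (Inf K)\<bar>) < \<epsilon>"
    using assms unfolding abs_continuous_on_interval_def by blast
  then show thesis
    by (intro that[of \<delta>]) (simp_all add: division_variation_def)
qed

text \<open>On intervals shorter than the \<open>\<delta>\<close> belonging to \<open>\<epsilon> = 1\<close> the variation is at most \<open>1\<close>, so the
  bounded variation of \<open>f\<close> on all of \<open>[a,b]\<close> is not needed.\<close>

lemma abs_continuous_ae_differentiable:
  assumes f: "abs_continuous_on_interval a b f"
  shows "negligible {x \<in> {a<..<b}. \<not> f differentiable at x}"
proof -
  obtain \<delta> where \<delta>: "\<delta> > 0"
    "\<And>D. D division_of \<Union>D \<Longrightarrow> \<Union>D \<subseteq> {a..b} \<Longrightarrow> (\<Sum>K\<in>D. Sup K - Inf K) < \<delta> \<Longrightarrow>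
        division_variation f D < 1"
    using abs_continuousE[OF f zero_less_one] by blast
  let ?R = "{(c, d) \<in> \<rat> \<times> \<rat>. a \<le> c \<and> c < d \<and> d \<le> b \<and> d - c < \<delta>}"
  have "negligible {x \<in> {c<..<d}. \<not> f differentiable at x}"
    if cd: "a \<le> c" "c < d" "d \<le> b" "d - c < \<delta>" for c d
  proof (rule bounded_variation_ae_differentiable[OF cd(2)])
    fix D assume D: "D division_of {c..d}"
    have U: "\<Union>D = {c..d}" using D by auto
    have "(\<Sum>K\<in>D. Sup K - Inf K) = d - c"
      using division_telescope[OF _ D, of "\<lambda>x. x"] cd by simp
    then show "division_variation f D \<le> 1"
      using \<delta>(2)[of D] D cd unfolding U by (simp add: less_imp_le)
  qed
  moreover have "countable ?R"
    by (rule countable_subset[of _ "\<rat> \<times> \<rat>"]) (auto intro: countable_rat)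
  ultimately have "negligible (\<Union>(c, d)\<in>?R. {x \<in> {c<..<d}. \<not> f differentiable at x})"
    by (intro negligible_countable_Union) auto
  then show ?thesis
  proof (rule negligible_subset, intro subsetI)
    fix x assume "x \<in> {x \<in> {a<..<b}. \<not> f differentiable at x}"
    then have x: "x \<in> {a<..<b}" "\<not> f differentiable at x" by auto
    obtain c where c: "c \<in> \<rat>" "max a (x - \<delta> / 2) < c" "c < x"
      using Rats_dense_in_real[of "max a (x - \<delta> / 2)" x] x \<delta>(1) by auto
    obtain d where d: "d \<in> \<rat>" "x < d" "d < min b (x + \<delta> / 2)"
      using Rats_dense_in_real[of x "min b (x + \<delta> / 2)"] x \<delta>(1) by auto
    have "(c, d) \<in> ?R" using c d x by auto
    moreover have "x \<in> {x \<in> {c<..<d}. \<not> f differentiable at x}" using c d x by simp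
    ultimately show "x \<in> (\<Union>(c, d)\<in>?R. {x \<in> {c<..<d}. \<not> f differentiable at x})"
      by blast
  qed
qed

text \<open>A gauge argument. At points of differentiability the Riemann terms are close to the
  increments. At exceptional tags the integrand is set to 0, and the gauge confines the intervals to
  an open set so small that absolute continuity controls their increments.\<close>

theorem abs_continuous_has_integral_deriv:
  assumes ab: "a < b" and f: "abs_continuous_on_interval a b f"
  shows "(deriv f has_integral f b - f a) {a..b}"
proof -
  \<comment> \<open>The endpoints count as exceptional because \<open>deriv\<close> there also
    depends on values of \<open>f\<close> outside the interval.\<close>
  define N where "N = {a, b} \<union> {x \<in> {a<..<b}. \<not> f differentiable at x}"
  have N: "negligible N"
    unfolding N_def using abs_continuous_ae_differentiable[OF f] by (simp add: negligible_insert)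
  define g where "g x = (if x \<in> N then 0 else deriv f x)" for x
  have "(g has_integral f b - f a) {a..b}"
    unfolding has_integral_real
  proof (intro allI impI)
    fix e :: real assume e: "e > 0"
    define e1 where "e1 = e / (2 * (b - a))"
    have e1: "e1 > 0" using e ab by (simp add: e1_def)
    obtain \<delta> where \<delta>: "\<delta> > 0"
      "\<And>D. D division_of \<Union>D \<Longrightarrow> \<Union>D \<subseteq> {a..b} \<Longrightarrow> (\<Sum>K\<in>D. Sup K - Inf K) < \<delta> \<Longrightarrow>
        division_variation f D < e / 2"
      using abs_continuousE[OF f half_gt_zero[OF e]] by blast
    obtain U where U: "open U" "N \<subseteq> U" "U - N \<in> lmeasurable" "emeasure lebesgue (U - N) < ennreal \<delta>"
      using sets_lebesgue_outer_open[OF negligible_imp_sets[OF N] \<delta>(1)] by blast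
    have Um: "U \<in> lmeasurable" "measure lebesgue U < \<delta>"
    proof -
      have eq: "U = (U - N) \<union> N" using U by auto
      have "N \<in> lmeasurable" "measure lebesgue N = 0"
        using N by (simp_all add: negligible_imp_measurable negligible_imp_measure0)
      then show "U \<in> lmeasurable" using U(3) eq by (metis fmeasurable.Un)
      have "measure lebesgue U \<le> measure lebesgue (U - N) + measure lebesgue N"
        using measure_Un_le[of "U - N" lebesgue N] eq U(3) \<open>N \<in> lmeasurable\<close> by (metis fmeasurableD)
      moreover have "measure lebesgue (U - N) < \<delta>"
        using U(3,4) by (simp add: emeasure_eq_measure2 ennreal_less_iff)
      ultimately show "measure lebesgue U < \<delta>" using \<open>measure lebesgue N = 0\<close> by simp
    qed
    have "\<exists>d>0. x \<in> {a..b} - N \<longrightarrow> (\<forall>y. \<bar>y - x\<bar> < d \<longrightarrow> \<bar>f y - f x - (y - x) * g x\<bar> \<le> e1 * \<bar>y - x\<bar>)" for x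
    proof (cases "x \<in> {a..b} - N")
      case True
      then have "f differentiable at x" "g x = deriv f x" by (auto simp: N_def g_def)
      then have "(f has_derivative (\<lambda>h. h * g x)) (at x)"
        using DERIV_deriv_iff_real_differentiable
        by (metis has_field_derivative_def mult_commute_abs)
      then obtain d where "d > 0" "\<forall>y. norm (y - x) < d \<longrightarrow>
          norm (f y - f x - (y - x) * g x) \<le> e1 * norm (y - x)"
        unfolding has_derivative_at_alt using e1 by blast
      then show ?thesis by auto
    qed (auto intro: exI[of _ 1])
    then obtain d where d: "\<And>x. d x > 0"
      "\<And>x y. x \<in> {a..b} - N \<Longrightarrow> \<bar>y - x\<bar> < d x \<Longrightarrow> \<bar>f y - f x - (y - x) * g x\<bar> \<le> e1 * \<bar>y - x\<bar>"
      by metis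
    define \<gamma> where "\<gamma> x = (if x \<in> N then U else ball x (d x))" for x
    have gauge: "gauge \<gamma>" unfolding gauge_def \<gamma>_def using U d(1) by auto
    have "norm ((\<Sum>(x, K)\<in>p. measure lborel K *\<^sub>R g x) - (f b - f a)) < e"
      if p: "p tagged_division_of {a..b}" and fine: "\<gamma> fine p" for p
    proof -
      let ?\<Delta> = "\<lambda>K. f (Sup K) - f (Inf K)"
      have finp: "finite p" using p by auto
      define p1 where "p1 = {z \<in> p. fst z \<in> N}"
      define p2 where "p2 = {z \<in> p. fst z \<notin> N}"
      have pp: "p = p1 \<union> p2" "p1 \<inter> p2 = {}" "finite p1" "finite p2"
        using finp by (auto simp: p1_def p2_def)
      have K: "\<exists>u v. K = {u..v} \<and> u \<le> x \<and> x \<le> v \<and> a \<le> u \<and> v \<le> b" if xK: "(x, K) \<in> p" for x K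
      proof -
        obtain u v where uv: "K = cbox u v" using tagged_division_ofD(4)[OF p xK] by blast
        have "x \<in> K" "K \<subseteq> {a..b}" using tagged_division_ofD(2,3)[OF p xK] by auto
        then show ?thesis using uv by (intro exI[of _ u] exI[of _ v]) auto
      qed
      have "(\<Sum>(x, K)\<in>p. measure lborel K *\<^sub>R g x) - (f b - f a) = (\<Sum>(x, K)\<in>p. measure lborel K * g x - ?\<Delta> K)"
        using additive_tagged_division_1[OF _ p, of f] ab
        by (simp add: sum_subtractf case_prod_beta)
      also have "\<dots> = (\<Sum>(x, K)\<in>p1. measure lborel K * g x - ?\<Delta> K) + (\<Sum>(x, K)\<in>p2. measure lborel K * g x - ?\<Delta> K)"
        unfolding pp(1) using pp by (intro sum.union_disjoint) auto
      finally have split: "(\<Sum>(x, K)\<in>p. measure lborel K *\<^sub>R g x) - (f b - f a) =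
          (\<Sum>(x, K)\<in>p1. measure lborel K * g x - ?\<Delta> K) + (\<Sum>(x, K)\<in>p2. measure lborel K * g x - ?\<Delta> K)" .
      have "\<bar>\<Sum>(x, K)\<in>p2. measure lborel K * g x - ?\<Delta> K\<bar> \<le> (\<Sum>(x, K)\<in>p2. e1 * (Sup K - Inf K))"
        unfolding case_prod_beta
      proof (rule sum_norm_le[where 'a = real, unfolded real_norm_def])
        fix z assume z: "z \<in> p2"
        obtain x L where xL: "z = (x, L)" by (cases z)
        have xp: "(x, L) \<in> p" "x \<notin> N" using z xL by (auto simp: p2_def)
        obtain u v where uv: "L = {u..v}" "u \<le> x" "x \<le> v" "a \<le> u" "v \<le> b" using K[OF xp(1)] by blast
        have "L \<subseteq> ball x (d x)" using fine xp unfolding fine_def \<gamma>_def by force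
        moreover have "u \<in> L" "v \<in> L" using uv by auto
        ultimately have "u \<in> ball x (d x)" "v \<in> ball x (d x)" by auto
        then have "\<bar>f u - f x - (u - x) * g x\<bar> \<le> e1 * \<bar>u - x\<bar>" "\<bar>f v - f x - (v - x) * g x\<bar> \<le> e1 * \<bar>v - x\<bar>"
          using d(2)[of x u] d(2)[of x v] xp uv by (auto simp: dist_real_def)
        moreover have "measure lborel L * g x - ?\<Delta> L =
            (f u - f x - (u - x) * g x) - (f v - f x - (v - x) * g x)"
          using uv by (simp add: algebra_simps)
        moreover have "e1 * \<bar>u - x\<bar> + e1 * \<bar>v - x\<bar> = e1 * (Sup L - Inf L)"
          using uv by (simp add: algebra_simps)
        ultimately show "\<bar>measure lborel (snd z) * g (fst z) - ?\<Delta> (snd z)\<bar> \<le> e1 * (Sup (snd z) - Inf (snd z))"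
          unfolding xL by simp
      qed
      also have "\<dots> \<le> (\<Sum>(x, K)\<in>p. e1 * (Sup K - Inf K))"
      proof (rule sum_mono2[OF finp])
        show "p2 \<subseteq> p" by (auto simp: p2_def)
        fix z assume "z \<in> p - p2"
        then obtain u v where "snd z = {u..v}" "u \<le> v" using K[of "fst z" "snd z"] by auto
        then show "0 \<le> (case z of (x, K) \<Rightarrow> e1 * (Sup K - Inf K))"
          using e1 by (simp add: case_prod_beta)
      qed
      also have "\<dots> = e1 * (b - a)"
        using additive_tagged_division_1[OF _ p, of "\<lambda>x. x"] ab
        by (simp add: case_prod_beta flip: sum_distrib_left)
      also have "\<dots> = e / 2" using ab by (simp add: e1_def nonzero_divide_eq_eq algebra_simps)
      finally have part2: "\<bar>\<Sum>(x, K)\<in>p2. measure lborel K * g x - ?\<Delta> K\<bar> \<le> e / 2" .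
      have K1: "\<exists>u v. L = {u..v} \<and> u \<le> v \<and> {u..v} \<subseteq> {a..b} \<and> {u..v} \<subseteq> U" if L: "L \<in> snd ` p1" for L
      proof -
        obtain z where "z \<in> p1" "L = snd z" using L by blast
        then obtain x where x: "(x, L) \<in> p" "x \<in> N" by (cases z) (auto simp: p1_def)
        obtain u v where uv: "L = {u..v}" "u \<le> x" "x \<le> v" "a \<le> u" "v \<le> b" using K[OF x(1)] by blast
        moreover have "L \<subseteq> U" using fine x unfolding fine_def \<gamma>_def by force
        ultimately show ?thesis by (intro exI[of _ u] exI[of _ v]) simp
      qed
      have K2: "L \<subseteq> {a..b}" "L \<subseteq> U" if "L \<in> snd ` p1" for L
        using K1[OF that] by (elim exE conjE; simp)+
      \<comment> \<open>An interval can carry two tags only if it is degenerate.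
        \<open>over_tagged_division_lemma\<close> therefore asks for the value 0 on all degenerate
        intervals, the empty one included, which explains the guard.\<close>
      have "\<bar>\<Sum>(x, K)\<in>p1. measure lborel K * g x - ?\<Delta> K\<bar> \<le> (\<Sum>(x, K)\<in>p1. if K = {} then 0 else \<bar>?\<Delta> K\<bar>)"
        unfolding case_prod_beta
      proof (rule sum_norm_le[where 'a = real, unfolded real_norm_def])
        fix z assume z: "z \<in> p1"
        then have "snd z \<noteq> {}" using K[of "fst z" "snd z"] by (auto simp: p1_def)
        moreover have "g (fst z) = 0" using z by (simp add: p1_def g_def)
        ultimately show "\<bar>measure lborel (snd z) * g (fst z) - ?\<Delta> (snd z)\<bar> \<le>
            (if snd z = {} then 0 else \<bar>?\<Delta> (snd z)\<bar>)" by simp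
      qed
      also have "\<dots> = (\<Sum>K\<in>snd ` p1. if K = {} then 0 else \<bar>?\<Delta> K\<bar>)"
      proof (rule sum.over_tagged_division_lemma)
        have "p1 tagged_partial_division_of {a..b}"
          using tagged_partial_division_subset[of p "{a..b}" p1] p
          by (auto simp: p1_def tagged_division_of_def)
        then show "p1 tagged_division_of \<Union>(snd ` p1)" by (rule tagged_partial_division_of_Union_self)
      qed auto
      also have "\<dots> = (\<Sum>K\<in>snd ` p1. \<bar>?\<Delta> K\<bar>)"
      proof (rule sum.cong)
        fix L assume "L \<in> snd ` p1"
        then have "L \<noteq> {}" using K1 by fastforce
        then show "(if L = {} then 0 else \<bar>?\<Delta> L\<bar>) = \<bar>?\<Delta> L\<bar>" by simp
      qed simp
      also have "\<dots> = division_variation f (snd ` p1)" by (simp add: division_variation_def)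
      also have "\<dots> < e / 2"
      proof (rule \<delta>(2))
        have "p1 tagged_partial_division_of {a..b}"
          using tagged_partial_division_subset[of p "{a..b}" p1] p
          by (auto simp: p1_def tagged_division_of_def)
        then show D: "snd ` p1 division_of \<Union>(snd ` p1)" by (rule partial_division_of_tagged_division)
        show "\<Union>(snd ` p1) \<subseteq> {a..b}" by (intro Union_least K2)
        have "Sup L - Inf L = measure lebesgue L" if L: "L \<in> snd ` p1" for L
        proof -
          obtain u v where "L = {u..v}" "u \<le> v" using K1[OF L] by (elim exE conjE)
          then show ?thesis by simp
        qed
        then have "(\<Sum>K\<in>snd ` p1. Sup K - Inf K) = (\<Sum>K\<in>snd ` p1. measure lebesgue K)"
          by (rule sum.cong[OF refl])
        also have "\<dots> = measure lebesgue (\<Union>(snd ` p1))" using content_division[OF D] by simp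
        also have "\<dots> \<le> measure lebesgue U"
        proof (rule measure_mono_fmeasurable)
          show "\<Union>(snd ` p1) \<subseteq> U" by (intro Union_least K2)
          show "\<Union>(snd ` p1) \<in> sets lebesgue" using lmeasurable_division[OF D] by (rule fmeasurableD)
        qed (rule Um)
        also have "\<dots> < \<delta>" by (rule Um)
        finally show "(\<Sum>K\<in>snd ` p1. Sup K - Inf K) < \<delta>" .
      qed
      finally show ?thesis unfolding split real_norm_def using part2 by linarith
    qed
    with gauge show "\<exists>\<gamma>. gauge \<gamma> \<and> (\<forall>p. p tagged_division_of {a..b} \<and> \<gamma> fine p \<longrightarrow>
        norm ((\<Sum>(x, K)\<in>p. measure lborel K *\<^sub>R g x) - (f b - f a)) < e)"
      by (intro exI[of _ \<gamma>]) simp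
  qed
  then show ?thesis
    by (rule has_integral_spike[OF N, rotated]) (simp add: g_def)
qed

section \<open>Piecewise linear loops\<close>

lemma lipschitz_imp_abs_continuous:
  fixes f :: "real \<Rightarrow> real"
  assumes lip: "\<And>s t. \<bar>f s - f t\<bar> \<le> L * \<bar>s - t\<bar>"
  shows "abs_continuous_on_interval a b f"
  unfolding abs_continuous_on_interval_def
proof (intro allI impI)
  fix \<epsilon> :: real assume \<epsilon>: "\<epsilon> > 0"
  have "0 \<le> \<bar>f 1 - f 0\<bar>" by simp
  also have "\<dots> \<le> L" using lip[of 1 0] by simp
  finally have L: "L \<ge> 0" .
  have "(\<Sum>K\<in>D. \<bar>f (Sup K) - f (Inf K)\<bar>) < \<epsilon>"
    if D: "D division_of \<Union>D" and le: "(\<Sum>K\<in>D. Sup K - Inf K) < \<epsilon> / (L + 1)" for D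
  proof -
    have len: "Inf K \<le> Sup K" if "K \<in> D" for K
      using division_ofD(3,4)[OF D that] by auto
    have "(\<Sum>K\<in>D. \<bar>f (Sup K) - f (Inf K)\<bar>) \<le> (\<Sum>K\<in>D. (L + 1) * (Sup K - Inf K))"
    proof (rule sum_mono)
      fix K assume "K \<in> D"
      then have "\<bar>f (Sup K) - f (Inf K)\<bar> \<le> L * (Sup K - Inf K)"
        using lip[of "Sup K" "Inf K"] len by simp
      also have "\<dots> \<le> (L + 1) * (Sup K - Inf K)"
        using len[OF \<open>K \<in> D\<close>] by (intro mult_right_mono) auto
      finally show "\<bar>f (Sup K) - f (Inf K)\<bar> \<le> (L + 1) * (Sup K - Inf K)" .
    qed
    also have "\<dots> = (L + 1) * (\<Sum>K\<in>D. Sup K - Inf K)" by (simp add: sum_distrib_left)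
    also have "\<dots> < (L + 1) * (\<epsilon> / (L + 1))" using le L by (intro mult_strict_left_mono) auto
    finally show ?thesis using L by simp
  qed
  then show "\<exists>\<delta>>0. \<forall>D. D division_of \<Union>D \<and> \<Union>D \<subseteq> {a..b} \<and> (\<Sum>K\<in>D. Sup K - Inf K) < \<delta> \<longrightarrow>
      (\<Sum>K\<in>D. \<bar>f (Sup K) - f (Inf K)\<bar>) < \<epsilon>"
    using \<epsilon> L by (intro exI[of _ "\<epsilon> / (L + 1)"]) auto
qed

lemma ramp_has_real_derivative:
  fixes p q t :: real
  assumes "p \<le> q" "t \<noteq> p" "t \<noteq> q"
  shows "((\<lambda>t. min (max t p) q - p) has_real_derivative indicator {p<..<q} t) (at t)"
proof -
  consider "t < p" | "p < t" "t < q" | "q < t" using assms by linarith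
  then show ?thesis
  proof cases
    case 1
    have "((\<lambda>t. 0) has_real_derivative 0) (at t)" by simp
    then have "((\<lambda>t. min (max t p) q - p) has_real_derivative 0) (at t)"
      by (rule has_field_derivative_transform_within_open[where S = "{..<p}"])
        (use 1 assms in auto)
    then show ?thesis using 1 by simp
  next
    case 2
    have "((\<lambda>t. t - p) has_real_derivative 1) (at t)" by (auto intro!: derivative_eq_intros)
    then have "((\<lambda>t. min (max t p) q - p) has_real_derivative 1) (at t)"
      by (rule has_field_derivative_transform_within_open[where S = "{p<..<q}"])
        (use 2 assms in auto)
    then show ?thesis using 2 by simp
  next
    case 3
    have "((\<lambda>t. q - p) has_real_derivative 0) (at t)" by simp
    then have "((\<lambda>t. min (max t p) q - p) has_real_derivative 0) (at t)"
      by (rule has_field_derivative_transform_within_open[where S = "{q<..}"])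
        (use 3 assms in auto)
    then show ?thesis using 3 by simp
  qed
qed

text \<open>The loop has velocity \<open>a j\<close> for a time \<open>\<mu> j\<close>, and
  \<open>mean0\<close> closes it. Off a finite set of times the velocity takes finitely many values,
  so the formula holds for arbitrary \<open>F\<close>, in particular for \<open>u_opt\<close> and
  the Hamiltonian.\<close>

lemma piecewise_linear_loop:
  fixes a :: "nat \<Rightarrow> real ^ 'n" and \<mu> :: "nat \<Rightarrow> real"
  assumes pos: "\<And>j. 0 < \<mu> j" and sum1: "(\<Sum>j<k. \<mu> j) = 1"
    and mean0: "(\<Sum>j<k. \<mu> j *\<^sub>R a j) = 0"
  obtains y where "y \<in> Lambda_space \<sigma>"
    "\<And>F :: real ^ 'n \<Rightarrow> real. (LINT t:{0..1}|lebesgue. F (velocity y t)) = (\<Sum>j<k. \<mu> j * F (a j))"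
proof -
  define \<tau> where "\<tau> j = (\<Sum>i<j. \<mu> i)" for j
  have \<tau>Suc: "\<tau> (Suc j) = \<tau> j + \<mu> j" for j by (simp add: \<tau>_def)
  have \<tau>0: "\<tau> 0 = 0" and \<tau>k: "\<tau> k = 1" using sum1 by (simp_all add: \<tau>_def)
  \<comment> \<open>Positivity is assumed also from \<open>k\<close> on, so that
    \<open>\<tau>\<close> increases on all naturals and comparing breakpoints reduces to comparing
    indices.\<close>
  have "strict_mono \<tau>" by (rule strict_monoI_Suc) (simp add: \<tau>Suc pos)
  then have mono: "\<tau> i \<le> \<tau> j \<longleftrightarrow> i \<le> j" for i j by (simp add: strict_mono_less_eq)
  \<comment> \<open>The time spent in phase \<open>j\<close> up to time \<open>t\<close>.\<close>
  define r where "r j t = min (max t (\<tau> j)) (\<tau> (Suc j)) - \<tau> j" for j t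
  define y where "y t = (\<Sum>j<k. r j t *\<^sub>R a j)" for t
  have yi: "y t $ i = (\<Sum>j<k. r j t * a j $ i)" for t i by (simp add: y_def)
  have "y 0 = 0"
  proof -
    have "r j 0 = 0" for j
      using mono[of 0 j] mono[of j "Suc j"] by (simp add: r_def \<tau>0)
    then show ?thesis by (simp add: y_def)
  qed
  moreover have "y 1 = 0"
  proof -
    have "r j 1 = \<mu> j" if "j < k" for j
      using that mono[of "Suc j" k] mono[of j "Suc j"] mono[of j k] by (simp add: r_def \<tau>k \<tau>Suc)
    then have "y 1 = (\<Sum>j<k. \<mu> j *\<^sub>R a j)" by (simp add: y_def)
    then show ?thesis using mean0 by simp
  qed
  ultimately have per: "y 0 = y 1" by simp
  have ac: "abs_continuous_on_interval 0 1 (\<lambda>t. y t $ i)" for i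
  proof (rule lipschitz_imp_abs_continuous[where L = "\<Sum>j<k. \<bar>a j $ i\<bar>"])
    fix s t
    have "y s $ i - y t $ i = (\<Sum>j<k. (r j s - r j t) * a j $ i)"
      by (simp add: yi left_diff_distrib sum_subtractf)
    also have "\<bar>\<dots>\<bar> \<le> (\<Sum>j<k. \<bar>(r j s - r j t) * a j $ i\<bar>)" by (rule sum_abs)
    also have "\<dots> \<le> (\<Sum>j<k. \<bar>s - t\<bar> * \<bar>a j $ i\<bar>)"
      unfolding abs_mult r_def by (intro sum_mono mult_right_mono) auto
    also have "\<dots> = (\<Sum>j<k. \<bar>a j $ i\<bar>) * \<bar>s - t\<bar>"
      by (simp add: mult.commute flip: sum_distrib_left)
    finally show "\<bar>y s $ i - y t $ i\<bar> \<le> (\<Sum>j<k. \<bar>a j $ i\<bar>) * \<bar>s - t\<bar>" .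
  qed
  let ?N = "\<tau> ` {..k}"
  have vel: "velocity y t = (\<Sum>j<k. indicator {\<tau> j<..<\<tau> (Suc j)} t *\<^sub>R a j)" if "t \<notin> ?N" for t
  proof -
    have "((\<lambda>t. y t $ i) has_real_derivative (\<Sum>j<k. indicator {\<tau> j<..<\<tau> (Suc j)} t * a j $ i)) (at t)" for i
      unfolding yi r_def
    proof (intro DERIV_sum DERIV_cmult_right ramp_has_real_derivative)
      fix j assume "j \<in> {..<k}"
      then have "\<tau> j \<in> ?N" "\<tau> (Suc j) \<in> ?N" by auto
      then show "t \<noteq> \<tau> j" "t \<noteq> \<tau> (Suc j)" using that by blast+
    qed (simp add: mono)
    then show ?thesis by (simp add: velocity_def vec_eq_iff DERIV_imp_deriv)
  qed
  have F_vel: "F (velocity y t) = (\<Sum>j<k. indicator {\<tau> j<..<\<tau> (Suc j)} t * F (a j))"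
    if t: "t \<in> {0..1} - ?N" for t and F :: "real ^ 'n \<Rightarrow> real"
  proof -
    have "\<exists>l<k. \<tau> l < t \<and> t < \<tau> (Suc l)"
    proof -
      define n where "n = (LEAST n. t < \<tau> n)"
      have "1 \<in> ?N" using \<tau>k by (metis atMost_iff image_eqI order_refl)
      then have "t < \<tau> k" using t \<tau>k by (auto simp: less_le)
      then have n: "t < \<tau> n" "n \<le> k" unfolding n_def by (auto intro: LeastI Least_le)
      have "n \<noteq> 0" using n t \<tau>0 by (cases n) auto
      then obtain l where l: "n = Suc l" by (cases n) auto
      then have "\<not> t < \<tau> l" using not_less_Least[of l "\<lambda>n. t < \<tau> n"] by (simp add: n_def)
      moreover have "t \<noteq> \<tau> l" using t n l by auto
      ultimately show ?thesis using n l by (intro exI[of _ l]) auto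
    qed
    then obtain l where l: "l < k" "\<tau> l < t" "t < \<tau> (Suc l)" by blast
    have ind: "indicator {\<tau> j<..<\<tau> (Suc j)} t = (if j = l then 1 else 0 :: real)" for j
    proof (cases "j = l")
      case False
      then consider "Suc j \<le> l" | "Suc l \<le> j" by linarith
      then show ?thesis
      proof cases
        case 1
        then have "\<tau> (Suc j) \<le> \<tau> l" by (simp add: mono)
        then show ?thesis using l False by simp
      next
        case 2
        then have "\<tau> (Suc l) \<le> \<tau> j" by (simp add: mono)
        then show ?thesis using l False by simp
      qed
    qed (use l in simp)
    have "velocity y t = (\<Sum>j<k. indicator {\<tau> j<..<\<tau> (Suc j)} t *\<^sub>R a j)"
      using t by (intro vel) simp
    also have "\<dots> = (\<Sum>j<k. if j = l then a j else 0)"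
      by (intro sum.cong) (auto simp: ind)
    also have "\<dots> = a l" using l by simp
    finally have "F (velocity y t) = F (a l)" by simp
    also have "\<dots> = (\<Sum>j<k. if j = l then F (a j) else 0)" using l by simp
    also have "\<dots> = (\<Sum>j<k. indicator {\<tau> j<..<\<tau> (Suc j)} t * F (a j))"
      by (intro sum.cong) (auto simp: ind)
    finally show ?thesis .
  qed
  have neg: "negligible ?N" by (rule negligible_finite) simp
  have F_int: "set_integrable lebesgue {0..1} (\<lambda>t. F (velocity y t))"
    "(LINT t:{0..1}|lebesgue. F (velocity y t)) = (\<Sum>j<k. \<mu> j * F (a j))" for F :: "real ^ 'n \<Rightarrow> real"
  proof -
    let ?g = "\<lambda>t. \<Sum>j<k. indicator {\<tau> j<..<\<tau> (Suc j)} t * F (a j)"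
    have piece: "((\<lambda>t. indicator {\<tau> j<..<\<tau> (Suc j)} t * F (a j)) has_integral \<mu> j * F (a j)) {0..1}"
      "set_integrable lebesgue {0..1} (\<lambda>t. indicator {\<tau> j<..<\<tau> (Suc j)} t * F (a j))"
      if "j < k" for j
    proof -
      have sub: "{\<tau> j<..<\<tau> (Suc j)} \<subseteq> {0..1}"
        using that mono[of 0 j] mono[of "Suc j" k] \<tau>0 \<tau>k by auto
      have i: "set_integrable lebesgue {0..1} (indicator {\<tau> j<..<\<tau> (Suc j)} :: real \<Rightarrow> real)"
        by (simp add: set_integrable_def indicator_inter_arith[symmetric] lmeasurable_iff_integrable[symmetric] fmeasurable.Int)
      have "(indicator {\<tau> j<..<\<tau> (Suc j)} has_integral measure lebesgue {\<tau> j<..<\<tau> (Suc j)}) {0..1}"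
      proof (subst has_integral_restrict_UNIV[symmetric], rule has_integral_eq[rotated])
        show "(indicator {\<tau> j<..<\<tau> (Suc j)} has_integral measure lebesgue {\<tau> j<..<\<tau> (Suc j)}) UNIV"
          by (subst lmeasurable_iff_has_integral[symmetric]) simp
      qed (use sub in \<open>auto simp: indicator_def\<close>)
      then have "(indicator {\<tau> j<..<\<tau> (Suc j)} has_integral \<mu> j) {0..1}"
        using pos[of j] by (simp add: \<tau>Suc)
      then show "((\<lambda>t. indicator {\<tau> j<..<\<tau> (Suc j)} t * F (a j)) has_integral \<mu> j * F (a j)) {0..1}"
        by (rule has_integral_mult_left)
      show "set_integrable lebesgue {0..1} (\<lambda>t. indicator {\<tau> j<..<\<tau> (Suc j)} t * F (a j))"
        using i by (simp add: set_integrable_mult_left)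
    qed
    have g: "(?g has_integral (\<Sum>j<k. \<mu> j * F (a j))) {0..1}"
      using piece(1) by (intro has_integral_sum) auto
    have "set_integrable lebesgue {0..1} ?g"
      using piece(2) by (intro absolutely_integrable_sum) auto
    then show ai: "set_integrable lebesgue {0..1} (\<lambda>t. F (velocity y t))"
      by (rule absolutely_integrable_spike[OF _ neg]) (rule F_vel)
    have "((\<lambda>t. F (velocity y t)) has_integral (\<Sum>j<k. \<mu> j * F (a j))) {0..1}"
      by (rule has_integral_spike[OF neg _ g]) (rule F_vel)
    then show "(LINT t:{0..1}|lebesgue. F (velocity y t)) = (\<Sum>j<k. \<mu> j * F (a j))"
      using set_lebesgue_integral_eq_integral(2)[OF ai] by (simp add: integral_unique)
  qed
  have "(\<lambda>t. y t $ i) \<in> H_space \<sigma>" for i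
    using ac F_int(1)[of "\<lambda>v. \<bar>v $ i\<bar> powr \<sigma>"] by (simp add: H_space_def velocity_def)
  then have "y \<in> Lambda_space \<sigma>" using per by (simp add: Lambda_space_def)
  then show thesis using F_int(2) by (rule that)
qed

lemma piecewise_linear_loop_finite:
  fixes a :: "'b \<Rightarrow> real ^ 'n" and \<mu> :: "'b \<Rightarrow> real"
  assumes fin: "finite S" and pos: "\<And>x. x \<in> S \<Longrightarrow> 0 < \<mu> x" and sum1: "(\<Sum>x\<in>S. \<mu> x) = 1"
    and mean0: "(\<Sum>x\<in>S. \<mu> x *\<^sub>R a x) = 0"
  obtains y where "y \<in> Lambda_space \<sigma>"
    "\<And>F :: real ^ 'n \<Rightarrow> real. (LINT t:{0..1}|lebesgue. F (velocity y t)) = (\<Sum>x\<in>S. \<mu> x * F (a x))"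
proof -
  obtain e where e: "bij_betw e {..<card S} S"
    using ex_bij_betw_nat_finite[OF fin] by (auto simp: atLeast0LessThan)
  \<comment> \<open>The value 1 past the last index serves the positivity that
    \<open>piecewise_linear_loop\<close> demands at every index.\<close>
  define \<nu> where "\<nu> j = (if j < card S then \<mu> (e j) else 1)" for j
  have nu: "(\<Sum>j<card S. g (\<nu> j) (e j)) = (\<Sum>x\<in>S. g (\<mu> x) x)" for g :: "real \<Rightarrow> 'b \<Rightarrow> 'c::comm_monoid_add"
    using sum.reindex_bij_betw[OF e, of "\<lambda>x. g (\<mu> x) x"] by (simp add: \<nu>_def)
  show thesis
  proof (rule piecewise_linear_loop[of \<nu> "card S" "\<lambda>j. a (e j)" \<sigma>])
    show "0 < \<nu> j" for j using pos bij_betwE[OF e] by (auto simp: \<nu>_def)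
    show "(\<Sum>j<card S. \<nu> j) = 1" using nu[of "\<lambda>r x. r"] sum1 by simp
    show "(\<Sum>j<card S. \<nu> j *\<^sub>R a (e j)) = 0" using nu[of "\<lambda>r x. r *\<^sub>R a x"] mean0 by simp
  next
    fix y assume y: "y \<in> Lambda_space \<sigma>"
      "\<And>F :: real ^ 'n \<Rightarrow> real. (LINT t:{0..1}|lebesgue. F (velocity y t)) = (\<Sum>j<card S. \<nu> j * F (a (e j)))"
    show thesis
      by (rule that[OF y(1)]) (use y(2) nu[of "\<lambda>r x. r * _ (a x)"] in simp)
  qed
qed

section \<open>Conjugates of strictly convex functions\<close>

text \<open>Strict convexity is expressed by strict supporting lines.\<close>

lemma conjugate_lower_growth:
  fixes g :: "real \<Rightarrow> real"
  assumes sub: "\<And>\<eta>. \<exists>K. \<forall>\<xi>. \<xi> \<noteq> \<eta> \<longrightarrow> g \<xi> > g \<eta> + K * (\<xi> - \<eta>)"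
    and min: "\<And>\<xi>. g a \<le> g \<xi>" and e: "e > 0"
  shows "\<exists>\<delta>>0. \<forall>\<xi>\<ge>a + e. g \<xi> \<ge> g a + \<delta> * (\<xi> - a)"
proof -
  \<comment> \<open>The supporting line at this midpoint is at least \<open>g a\<close> there but
    below \<open>g a\<close> at \<open>a\<close>, so it rises. Beyond \<open>a + e\<close> the
    distance to the midpoint is at least half the distance to \<open>a\<close>, so half its slope
    works when measured from \<open>a\<close>.\<close>
  define \<eta> where "\<eta> = a + e / 2"
  obtain K where K: "\<And>\<xi>. \<xi> \<noteq> \<eta> \<Longrightarrow> g \<xi> > g \<eta> + K * (\<xi> - \<eta>)" using sub by blast
  have "g a > g \<eta> + K * (a - \<eta>)" using e by (intro K) (simp add: \<eta>_def)
  then have "0 < K * (e / 2)" using min[of \<eta>] by (simp add: \<eta>_def algebra_simps)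
  then have K0: "K > 0" using e by (simp add: zero_less_mult_iff)
  have "g \<xi> \<ge> g a + K / 2 * (\<xi> - a)" if "\<xi> \<ge> a + e" for \<xi>
  proof -
    have "g \<xi> > g \<eta> + K * (\<xi> - \<eta>)" using that e by (intro K) (simp add: \<eta>_def)
    moreover have "K * (\<xi> - \<eta>) \<ge> K * ((\<xi> - a) / 2)"
      using K0 that by (intro mult_left_mono) (auto simp: \<eta>_def)
    moreover have "K * ((\<xi> - a) / 2) = K / 2 * (\<xi> - a)" by simp
    ultimately show ?thesis using min[of \<eta>] by linarith
  qed
  then show ?thesis using K0 by (intro exI[of _ "K / 2"]) auto
qed

text \<open>Inserting \<open>\<xi> = a\<close> gives the lower bound \<open>p * a - g a\<close>. For
  the upper bound, linear growth of \<open>g\<close> absorbs a small \<open>p\<close> at distance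
  \<open>e\<close> or more from \<open>a\<close>, and closer to \<open>a\<close> the error is at
  most \<open>\<bar>p\<bar> * e\<close>.\<close>

lemma conjugate_has_real_derivative:
  fixes g :: "real \<Rightarrow> real"
  assumes sub: "\<And>\<eta>. \<exists>K. \<forall>\<xi>. \<xi> \<noteq> \<eta> \<longrightarrow> g \<xi> > g \<eta> + K * (\<xi> - \<eta>)"
    and min: "\<And>\<xi>. g a \<le> g \<xi>"
  shows "((\<lambda>p. SUP \<xi>. p * \<xi> - g \<xi>) has_real_derivative a) (at 0)"
    and "(SUP \<xi>. - g \<xi>) = - g a"
proof -
  let ?H = "\<lambda>p. SUP \<xi>. p * \<xi> - g \<xi>"
  show H0: "(SUP \<xi>. - g \<xi>) = - g a"
    using min by (intro cSup_eq_maximum) auto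
  have bound: "\<exists>\<delta>>0. \<forall>p. \<bar>p\<bar> \<le> \<delta> \<longrightarrow> (\<forall>\<xi>. p * \<xi> - g \<xi> \<le> - g a + p * a + \<bar>p\<bar> * e)" if e: "e > 0" for e
  proof -
    obtain \<delta>1 where d1: "\<delta>1 > 0" "\<And>\<xi>. \<xi> \<ge> a + e \<Longrightarrow> g \<xi> \<ge> g a + \<delta>1 * (\<xi> - a)"
      using conjugate_lower_growth[of g a, OF sub min e] by blast
    \<comment> \<open>The growth to the left of \<open>a\<close> comes from the reflected function,
      whose minimum is at \<open>- a\<close>.\<close>
    have "\<exists>K. \<forall>\<xi>. \<xi> \<noteq> \<eta> \<longrightarrow> g (- \<xi>) > g (- \<eta>) + K * (\<xi> - \<eta>)" for \<eta>
    proof -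
      obtain K where "\<forall>\<xi>. \<xi> \<noteq> - \<eta> \<longrightarrow> g \<xi> > g (- \<eta>) + K * (\<xi> - (- \<eta>))" using sub[of "- \<eta>"] by blast
      then show ?thesis
        by (intro exI[of _ "- K"]) (auto simp: algebra_simps dest: spec[of _ "- _"])
    qed
    then obtain \<delta>2 where d2: "\<delta>2 > 0" "\<And>\<xi>. \<xi> \<ge> - a + e \<Longrightarrow> g (- \<xi>) \<ge> g a + \<delta>2 * (\<xi> + a)"
      using conjugate_lower_growth[of "\<lambda>\<xi>. g (- \<xi>)" "- a" e] min e by auto
    have "p * \<xi> - g \<xi> \<le> - g a + p * a + \<bar>p\<bar> * e" if p: "\<bar>p\<bar> \<le> min \<delta>1 \<delta>2" for p \<xi>
    proof -
      have "p * (\<xi> - a) \<le> \<bar>p\<bar> * \<bar>\<xi> - a\<bar>" by (metis abs_ge_self abs_mult)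
      then have le: "p * \<xi> \<le> p * a + \<bar>p\<bar> * \<bar>\<xi> - a\<bar>" by (simp add: algebra_simps)
      consider "\<xi> \<ge> a + e" | "\<xi> \<le> a - e" | "\<bar>\<xi> - a\<bar> \<le> e" by linarith
      then have "\<bar>p\<bar> * \<bar>\<xi> - a\<bar> \<le> g \<xi> - g a + \<bar>p\<bar> * e"
      proof cases
        case 1
        have "\<bar>p\<bar> * \<bar>\<xi> - a\<bar> \<le> \<delta>1 * (\<xi> - a)" using p 1 e by (intro mult_mono) auto
        moreover have "0 \<le> \<bar>p\<bar> * e" using e by simp
        ultimately show ?thesis using d1(2)[OF 1] by linarith
      next
        case 2
        have "\<bar>p\<bar> * \<bar>\<xi> - a\<bar> \<le> \<delta>2 * (- \<xi> + a)" using p 2 e by (intro mult_mono) auto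
        moreover have "0 \<le> \<bar>p\<bar> * e" using e by simp
        moreover have "g \<xi> \<ge> g a + \<delta>2 * (- \<xi> + a)" using d2(2)[of "- \<xi>"] 2 by simp
        ultimately show ?thesis by linarith
      next
        case 3
        then have "\<bar>p\<bar> * \<bar>\<xi> - a\<bar> \<le> \<bar>p\<bar> * e" by (intro mult_left_mono) auto
        then show ?thesis using min[of \<xi>] by linarith
      qed
      then show ?thesis using le by linarith
    qed
    then show ?thesis using d1 d2 by (intro exI[of _ "min \<delta>1 \<delta>2"]) auto
  qed
  show "(?H has_real_derivative a) (at 0)"
    unfolding has_field_derivative_def has_derivative_at_alt
  proof (intro conjI allI impI)
    show "bounded_linear ((*) a)" by (rule bounded_linear_mult_right)
    fix e :: real assume e: "e > 0"
    obtain \<delta> where \<delta>: "\<delta> > 0"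
      "\<And>p \<xi>. \<bar>p\<bar> \<le> \<delta> \<Longrightarrow> p * \<xi> - g \<xi> \<le> - g a + p * a + \<bar>p\<bar> * e" using bound[OF e] by blast
    have "\<bar>?H p - ?H 0 - a * p\<bar> \<le> e * \<bar>p\<bar>" if p: "\<bar>p\<bar> < \<delta>" for p
    proof -
      have "?H p \<le> - g a + p * a + \<bar>p\<bar> * e"
        using \<delta>(2)[of p] p by (intro cSUP_least) auto
      moreover have "?H p \<ge> p * a - g a"
        using \<delta>(2)[of p] p by (intro cSUP_upper) (auto intro!: bdd_aboveI[of _ "- g a + p * a + \<bar>p\<bar> * e"])
      moreover have "?H 0 = - g a" using H0 by simp
      ultimately show ?thesis by (simp add: abs_le_iff algebra_simps)
    qed
    then show "\<exists>d>0. \<forall>y. norm (y - 0) < d \<longrightarrow> norm (?H y - ?H 0 - a * (y - 0)) \<le> e * norm (y - 0)"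
      using \<delta>(1) by auto
  qed
qed

text \<open>Bernoulli's inequality for real exponents by the mean value theorem; for
  \<open>x \<le> 0\<close> the tangent is at most \<open>1 - \<sigma>\<close>, hence
  negative.\<close>

lemma powr_gt_tangent_at_one:
  fixes x \<sigma> :: real
  assumes \<sigma>: "\<sigma> > 1" and "x \<noteq> 1"
  shows "\<bar>x\<bar> powr \<sigma> > 1 + \<sigma> * (x - 1)"
proof -
  have D: "((\<lambda>x. x powr \<sigma>) has_real_derivative \<sigma> * z powr (\<sigma> - 1)) (at z)" if "z > 0" for z
    using that by (auto intro!: derivative_eq_intros)
  consider "x > 1" | "x \<le> 0" | "0 < x" "x < 1" using \<open>x \<noteq> 1\<close> by linarith
  then show ?thesis
  proof cases
    case 1
    then obtain z where z: "1 < z" "z < x" "x powr \<sigma> - 1 powr \<sigma> = (x - 1) * (\<sigma> * z powr (\<sigma> - 1))"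
      using MVT2[of 1 x "\<lambda>x. x powr \<sigma>" "\<lambda>z. \<sigma> * z powr (\<sigma> - 1)"] D by auto
    have "z powr (\<sigma> - 1) > 1" using z \<sigma> by (simp add: gr_one_powr)
    then have "(x - 1) * (\<sigma> * z powr (\<sigma> - 1)) > (x - 1) * (\<sigma> * 1)"
      using 1 \<sigma> by (intro mult_strict_left_mono) auto
    then show ?thesis using z(3) 1 by (simp add: mult.commute)
  next
    case 2
    have "\<sigma> * (x - 1) \<le> - \<sigma>" using 2 \<sigma> by (simp add: algebra_simps mult_le_0_iff)
    moreover have "0 \<le> \<bar>x\<bar> powr \<sigma>" by simp
    ultimately show ?thesis using \<sigma> by linarith
  next
    case 3
    then obtain z where z: "x < z" "z < 1" "1 powr \<sigma> - x powr \<sigma> = (1 - x) * (\<sigma> * z powr (\<sigma> - 1))"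
      using MVT2[of x 1 "\<lambda>x. x powr \<sigma>" "\<lambda>z. \<sigma> * z powr (\<sigma> - 1)"] D by auto
    have "z powr (\<sigma> - 1) < 1 powr (\<sigma> - 1)" using z 3 \<sigma> by (intro powr_less_mono2) auto
    then have "(1 - x) * (\<sigma> * z powr (\<sigma> - 1)) < (1 - x) * (\<sigma> * 1)"
      using 3 \<sigma> by (intro mult_strict_left_mono) auto
    then show ?thesis using z(3) 3 by (simp add: algebra_simps)
  qed
qed

lemma abs_le_one_plus_abs_powr:
  fixes x \<sigma> :: real
  assumes "\<sigma> > 1"
  shows "\<bar>x\<bar> \<le> 1 + \<bar>x\<bar> powr \<sigma>"
proof (cases "\<bar>x\<bar> \<le> 1")
  case False
  then have "\<bar>x\<bar> powr 1 \<le> \<bar>x\<bar> powr \<sigma>" using assms by (intro powr_mono) auto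
  then show ?thesis using False by simp
qed (simp add: add_increasing2)

text \<open>Homogeneity moves the point of contact from 1 to \<open>c\<close>: the tangent at 1 is
  applied to \<open>x / c\<close>.\<close>

lemma abs_powr_supporting_line:
  fixes \<sigma> c :: real
  assumes \<sigma>: "\<sigma> > 1"
  shows "\<exists>k. \<forall>x. x \<noteq> c \<longrightarrow> \<bar>x\<bar> powr \<sigma> > \<bar>c\<bar> powr \<sigma> + k * (x - c)"
proof (cases "c = 0")
  case True
  then show ?thesis using \<sigma> by (intro exI[of _ 0]) auto
next
  case False
  have "\<bar>x\<bar> powr \<sigma> > \<bar>c\<bar> powr \<sigma> + \<bar>c\<bar> powr \<sigma> * \<sigma> / c * (x - c)" if "x \<noteq> c" for x
  proof -
    have "\<bar>x / c\<bar> powr \<sigma> > 1 + \<sigma> * (x / c - 1)"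
      using False that by (intro powr_gt_tangent_at_one \<sigma>) auto
    then have "\<bar>c\<bar> powr \<sigma> * \<bar>x / c\<bar> powr \<sigma> > \<bar>c\<bar> powr \<sigma> * (1 + \<sigma> * (x / c - 1))"
      using False by (intro mult_strict_left_mono) auto
    moreover have "\<bar>c\<bar> powr \<sigma> * \<bar>x / c\<bar> powr \<sigma> = \<bar>x\<bar> powr \<sigma>"
      using False by (simp add: powr_mult abs_divide powr_divide)
    moreover have "\<bar>c\<bar> powr \<sigma> * (1 + \<sigma> * (x / c - 1)) = \<bar>c\<bar> powr \<sigma> + \<bar>c\<bar> powr \<sigma> * \<sigma> / c * (x - c)"
      using False by (simp add: field_simps)
    ultimately show ?thesis by simp
  qed
  then show ?thesis by blast
qed

lemma continuous_on_abs_powr [continuous_intros]: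
  fixes f :: "'a::topological_space \<Rightarrow> real"
  assumes "continuous_on S f" "\<sigma> > 0"
  shows "continuous_on S (\<lambda>x. \<bar>f x\<bar> powr \<sigma>)"
  using assms by (intro continuous_on_powr' continuous_intros) auto

section \<open>The optimal shift\<close>

locale homogeneous_lagrangian =
  fixes \<sigma> :: real and m :: "real ^ 'n"
  assumes sigma: "\<sigma> > 1" and mass_pos: "\<And>i. 0 < m $ i" and mass_sum: "(\<Sum>i\<in>UNIV. m $ i) = 1"
begin

abbreviation u :: "real ^ 'n \<Rightarrow> real" where
  "u \<equiv> u_opt \<sigma> m"

definition cost :: "real ^ 'n \<Rightarrow> real" where
  "cost v = (\<Sum>i\<in>UNIV. m $ i * \<bar>v $ i\<bar> powr \<sigma>)"

text \<open>Expressed by inequalities between costs rather than through \<open>u\<close>, so that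
  closedness is that of an intersection of closed sets and scaling follows from homogeneity.\<close>

definition balanced :: "(real ^ 'n) set" where
  "balanced = {w. \<forall>\<xi>. cost w \<le> cost (w + vec \<xi>)}"

lemma lagrangian_eq: "lagrangian \<sigma> m \<xi> v = cost (v + vec \<xi>)"
  by (simp add: lagrangian_def cost_def)

lemma vec_shift: "v + vec a + vec b = (v + vec (a + b) :: real ^ 'n)"
  by (simp add: vec_eq_iff)

lemma cost_nonneg: "0 \<le> cost v"
  unfolding cost_def by (intro sum_nonneg mult_nonneg_nonneg) (simp_all add: mass_pos less_imp_le)

lemma cost_coordinate: "m $ i * \<bar>v $ i\<bar> powr \<sigma> \<le> cost v"
  unfolding cost_def
  by (rule member_le_sum) (simp_all add: mass_pos less_imp_le)

lemma continuous_on_cost: "continuous_on UNIV cost"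
  unfolding cost_def[abs_def] using sigma by (intro continuous_intros) auto

lemma continuous_on_cost' [continuous_intros]:
  "continuous_on A f \<Longrightarrow> continuous_on A (\<lambda>x. cost (f x))"
  using continuous_on_compose2[OF continuous_on_cost] by blast

lemma cost_scaleR: "cost (c *\<^sub>R v) = \<bar>c\<bar> powr \<sigma> * cost v"
  by (simp add: cost_def abs_mult powr_mult sum_distrib_left mult_ac)

text \<open>Strict convexity along the diagonal, in the form that the lemmas on conjugates take; the
  slope is the mass average of the coordinate slopes.\<close>

lemma cost_supporting_line:
  "\<exists>K. \<forall>\<xi>. \<xi> \<noteq> \<eta> \<longrightarrow> cost (v + vec \<xi>) > cost (v + vec \<eta>) + K * (\<xi> - \<eta>)"
proof -
  have "\<exists>k. \<forall>x. x \<noteq> v $ i + \<eta> \<longrightarrow> \<bar>x\<bar> powr \<sigma> > \<bar>v $ i + \<eta>\<bar> powr \<sigma> + k * (x - (v $ i + \<eta>))" for i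
    by (rule abs_powr_supporting_line[OF sigma])
  then obtain k where k: "\<And>i x. x \<noteq> v $ i + \<eta> \<Longrightarrow>
      \<bar>x\<bar> powr \<sigma> > \<bar>v $ i + \<eta>\<bar> powr \<sigma> + k i * (x - (v $ i + \<eta>))"
    by metis
  have "cost (v + vec \<xi>) > cost (v + vec \<eta>) + (\<Sum>i\<in>UNIV. m $ i * k i) * (\<xi> - \<eta>)" if "\<xi> \<noteq> \<eta>" for \<xi>
  proof -
    have "(\<Sum>i\<in>UNIV. m $ i * (\<bar>v $ i + \<eta>\<bar> powr \<sigma> + k i * ((v $ i + \<xi>) - (v $ i + \<eta>)))) <
        (\<Sum>i\<in>UNIV. m $ i * \<bar>v $ i + \<xi>\<bar> powr \<sigma>)"
    proof (intro sum_strict_mono mult_strict_left_mono)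
      fix i
      show "\<bar>v $ i + \<eta>\<bar> powr \<sigma> + k i * ((v $ i + \<xi>) - (v $ i + \<eta>)) < \<bar>v $ i + \<xi>\<bar> powr \<sigma>"
        using that by (intro k) simp
    qed (simp_all add: mass_pos)
    then show ?thesis
      by (simp add: cost_def distrib_left sum.distrib sum_distrib_right mult.assoc)
  qed
  then show ?thesis by blast
qed

lemma cost_shift_minimizer: "\<exists>a. \<forall>\<xi>. cost (v + vec a) \<le> cost (v + vec \<xi>)"
proof -
  \<comment> \<open>A shift beyond \<open>2 * norm v\<close> leaves every coordinate at least as
    large in absolute value as the shift 0 does.\<close>
  let ?R = "2 * norm v"
  have "continuous_on {- ?R..?R} (\<lambda>\<xi>. cost (v + vec \<xi>))"
    unfolding cost_def[abs_def] using sigma by (auto intro!: continuous_intros)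
  then obtain a where a: "a \<in> {- ?R..?R}" "\<And>\<xi>. \<xi> \<in> {- ?R..?R} \<Longrightarrow> cost (v + vec a) \<le> cost (v + vec \<xi>)"
    using continuous_attains_inf[of "{- ?R..?R}" "\<lambda>\<xi>. cost (v + vec \<xi>)"] by auto
  have "cost (v + vec a) \<le> cost (v + vec \<xi>)" for \<xi>
  proof (cases "\<xi> \<in> {- ?R..?R}")
    case False
    have "cost (v + vec a) \<le> cost (v + vec 0)" by (rule a(2)) simp
    also have "\<dots> \<le> cost (v + vec \<xi>)"
      unfolding cost_def
    proof (intro sum_mono mult_left_mono powr_mono2)
      fix i
      have "\<bar>v $ i\<bar> \<le> norm v" by (rule component_le_norm_cart)
      then show "\<bar>(v + vec 0) $ i\<bar> \<le> \<bar>(v + vec \<xi>) $ i\<bar>" using False by auto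
    qed (use sigma mass_pos less_imp_le in auto)
    finally show ?thesis .
  qed (rule a(2))
  then show ?thesis by blast
qed

text \<open>Connects \<open>u\<close>, defined as a derivative, with minimisation. Uniqueness of the
  minimiser comes along, since every minimiser is the derivative of the Hamiltonian at 0.\<close>

lemma u_opt_unique:
  assumes "\<And>\<xi>. cost (v + vec a) \<le> cost (v + vec \<xi>)"
  shows "u v = a" and "hamiltonian \<sigma> m 0 v = - cost (v + vec a)"
proof -
  note * = conjugate_has_real_derivative[where g = "\<lambda>\<xi>. cost (v + vec \<xi>)", OF cost_supporting_line assms]
  show "u v = a"
    unfolding u_opt_def hamiltonian_def lagrangian_eq by (rule DERIV_imp_deriv[OF *(1)])
  show "hamiltonian \<sigma> m 0 v = - cost (v + vec a)"
    unfolding hamiltonian_def lagrangian_eq using *(2) by simp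
qed

lemma u_opt_minimizes: "cost (v + vec (u v)) \<le> cost (v + vec \<xi>)"
  using cost_shift_minimizer[of v] u_opt_unique(1)[of v] by metis

lemma hamiltonian_zero: "hamiltonian \<sigma> m 0 v = - cost (v + vec (u v))"
  using u_opt_minimizes u_opt_unique(2) by blast

lemma balanced_shift: "v + vec (u v) \<in> balanced"
  using u_opt_minimizes by (simp add: balanced_def vec_shift)

text \<open>Inverse direction of \<open>balanced_shift\<close>: with \<open>c = 1\<close> it turns
  balanced vectors into velocities of a loop whose mean shift is 1.\<close>

lemma balanced_minus_vec:
  assumes "w \<in> balanced"
  shows "u (w - vec c) = c" and "hamiltonian \<sigma> m 0 (w - vec c) = - cost w"
proof -
  have eq: "w - vec c + vec \<xi> = w + vec (\<xi> - c)" for \<xi> by (simp add: vec_eq_iff)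
  have w: "w + vec 0 = w" by (simp add: vec_eq_iff)
  have "cost (w - vec c + vec c) \<le> cost (w - vec c + vec \<xi>)" for \<xi>
    using assms unfolding eq by (simp add: balanced_def w)
  note * = u_opt_unique[of "w - vec c" c, OF this]
  show "u (w - vec c) = c" by (rule *)
  show "hamiltonian \<sigma> m 0 (w - vec c) = - cost w" using * by (simp add: eq w)
qed

lemma balanced_scaleR:
  assumes "w \<in> balanced"
  shows "c *\<^sub>R w \<in> balanced"
proof (cases "c = 0")
  case True
  moreover have "cost 0 = 0" by (simp add: cost_def)
  ultimately show ?thesis using cost_nonneg by (simp add: balanced_def)
next
  case False
  have "cost (c *\<^sub>R w) \<le> cost (c *\<^sub>R w + vec \<xi>)" for \<xi>
  proof -
    have "c *\<^sub>R w + vec \<xi> = c *\<^sub>R (w + vec (\<xi> / c))" using False by (simp add: vec_eq_iff field_simps)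
    then show ?thesis
      using assms by (simp add: cost_scaleR balanced_def mult_left_mono)
  qed
  then show ?thesis by (simp add: balanced_def)
qed

lemma closed_balanced: "closed balanced"
proof -
  have "balanced = (\<Inter>\<xi>. {w. cost w \<le> cost (w + vec \<xi>)})" by (auto simp: balanced_def)
  also have "closed \<dots>"
    by (intro closed_INT ballI closed_Collect_le continuous_intros)
  finally show ?thesis .
qed

lemma bounded_cost_sublevel: "bounded {w. cost w \<le> 1}"
proof -
  have "norm w \<le> (\<Sum>i\<in>UNIV. 1 + 1 / m $ i)" if "cost w \<le> 1" for w :: "real ^ 'n"
  proof -
    have "norm w \<le> (\<Sum>i\<in>UNIV. \<bar>w $ i\<bar>)" by (rule norm_le_l1_cart)
    also have "\<dots> \<le> (\<Sum>i\<in>UNIV. 1 + 1 / m $ i)"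
    proof (rule sum_mono)
      fix i
      have "\<bar>w $ i\<bar> powr \<sigma> \<le> 1 / m $ i"
        using cost_coordinate[of i w] that mass_pos[of i] by (simp add: field_simps)
      then show "\<bar>w $ i\<bar> \<le> 1 + 1 / m $ i" using abs_le_one_plus_abs_powr[OF sigma, of "w $ i"] by linarith
    qed
    finally show ?thesis .
  qed
  then show ?thesis by (auto simp: bounded_iff)
qed

text \<open>By convexity the minimiser is at most \<open>a\<close> exactly if \<open>a\<close>
  itself is optimal among the shifts from \<open>a\<close> on, and this is a closed condition on
  \<open>v\<close>.\<close>

lemma borel_measurable_u: "u \<in> borel_measurable borel"
proof (rule borel_measurableI_le)
  fix a
  have "u v \<le> a \<longleftrightarrow> (\<forall>\<xi>\<ge>a. cost (v + vec a) \<le> cost (v + vec \<xi>))" for v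
  proof
    assume le: "u v \<le> a"
    show "\<forall>\<xi>\<ge>a. cost (v + vec a) \<le> cost (v + vec \<xi>)"
    proof (cases "u v = a")
      case False
      obtain K where K: "\<And>\<xi>. \<xi> \<noteq> a \<Longrightarrow> cost (v + vec \<xi>) > cost (v + vec a) + K * (\<xi> - a)"
        using cost_supporting_line by blast
      have "K * (u v - a) < 0" using K[OF False] u_opt_minimizes[of v a] by linarith
      then have "K > 0" using le False by (auto simp: mult_less_0_iff)
      show ?thesis
      proof (intro allI impI)
        fix \<xi> assume "a \<le> \<xi>"
        then have "0 \<le> K * (\<xi> - a)" using \<open>K > 0\<close> by simp
        then show "cost (v + vec a) \<le> cost (v + vec \<xi>)" using K[of \<xi>] by (cases "\<xi> = a") auto
      qed
    qed (use u_opt_minimizes in auto)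
  next
    assume *: "\<forall>\<xi>\<ge>a. cost (v + vec a) \<le> cost (v + vec \<xi>)"
    show "u v \<le> a"
    proof (rule ccontr)
      assume n: "\<not> u v \<le> a"
      then have "cost (v + vec a) \<le> cost (v + vec (u v))" using * by simp
      then have "cost (v + vec a) \<le> cost (v + vec \<xi>)" for \<xi>
        using u_opt_minimizes[of v \<xi>] by linarith
      then have "u v = a" by (rule u_opt_unique)
      then show False using n by simp
    qed
  qed
  then have "{v \<in> space borel. u v \<le> a} = (\<Inter>\<xi>\<in>{a..}. {v. cost (v + vec a) \<le> cost (v + vec \<xi>)})"
    by auto
  also have "closed \<dots>"
    by (intro closed_INT ballI closed_Collect_le continuous_intros)
  finally show "{v \<in> space borel. u v \<le> a} \<in> sets borel" by simp
qed

text \<open>The pointwise form of strict Jensen: the tangents at 1 are summed with the masses.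
  Equality would need \<open>w = vec 1\<close>, which the shift by \<open>- 1\<close> brings from
  cost 1 to cost 0. Averaged over \<open>w\<close> with mean \<open>vec 1\<close>, the right-hand
  side becomes 1.\<close>

lemma cost_gt_tangent:
  assumes "w \<in> balanced"
  shows "cost w > 1 + \<sigma> * ((\<Sum>i\<in>UNIV. m $ i * w $ i) - 1)"
proof -
  have "w \<noteq> vec 1"
  proof
    assume "w = vec 1"
    then have "w + vec (- 1) = 0" by (simp add: vec_eq_iff)
    then have "cost (w + vec (- 1)) = 0" by (simp add: cost_def)
    moreover have "cost w = 1" using \<open>w = vec 1\<close> by (simp add: cost_def mass_sum)
    ultimately show False using assms by (auto simp: balanced_def dest: spec[of _ "- 1"])
  qed
  then obtain j where j: "w $ j \<noteq> 1" by (auto simp: vec_eq_iff)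
  have "(\<Sum>i\<in>UNIV. m $ i * (1 + \<sigma> * (w $ i - 1))) < cost w"
    unfolding cost_def
  proof (rule sum_strict_mono_ex1)
    show "\<forall>i\<in>UNIV. m $ i * (1 + \<sigma> * (w $ i - 1)) \<le> m $ i * \<bar>w $ i\<bar> powr \<sigma>"
    proof
      fix i
      have "1 + \<sigma> * (w $ i - 1) \<le> \<bar>w $ i\<bar> powr \<sigma>"
        using powr_gt_tangent_at_one[OF sigma, of "w $ i"] by (cases "w $ i = 1") auto
      then show "m $ i * (1 + \<sigma> * (w $ i - 1)) \<le> m $ i * \<bar>w $ i\<bar> powr \<sigma>"
        using mass_pos less_imp_le by (intro mult_left_mono) auto
    qed
    show "\<exists>i\<in>UNIV. m $ i * (1 + \<sigma> * (w $ i - 1)) < m $ i * \<bar>w $ i\<bar> powr \<sigma>"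
      using powr_gt_tangent_at_one[OF sigma j] mass_pos by (intro bexI[of _ j] mult_strict_left_mono) auto
  qed simp
  moreover have "(\<Sum>i\<in>UNIV. m $ i * (1 + \<sigma> * (w $ i - 1))) =
      (\<Sum>i\<in>UNIV. m $ i) + \<sigma> * ((\<Sum>i\<in>UNIV. m $ i * w $ i) - (\<Sum>i\<in>UNIV. m $ i))"
    by (simp add: algebra_simps sum.distrib sum_subtractf sum_distrib_left)
  ultimately show ?thesis by (simp add: mass_sum)
qed

end

section \<open>Integrals along a loop\<close>

lemma lebesgue_on_iff:
  fixes f :: "real \<Rightarrow> 'a::euclidean_space"
  shows "set_integrable lebesgue {0..1} f \<longleftrightarrow> integrable (lebesgue_on {0..1}) f"
    and "(LINT t:{0..1}|lebesgue. f t) = integral\<^sup>L (lebesgue_on {0..1}) f"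
  by (simp_all add: set_integrable_def set_lebesgue_integral_def integrable_restrict_space integral_restrict_space)

lemma lebesgue_on_unit_interval_const:
  fixes c :: real
  shows "integrable (lebesgue_on {0..1::real}) (\<lambda>t. c)"
    and "integral\<^sup>L (lebesgue_on {0..1::real}) (\<lambda>t. c) = c"
proof -
  interpret finite_measure "lebesgue_on {0..1::real}"
    by (rule finite_measure_lebesgue_on) simp
  show "integrable (lebesgue_on {0..1::real}) (\<lambda>t. c)" by simp
  show "integral\<^sup>L (lebesgue_on {0..1::real}) (\<lambda>t. c) = c"
    by (simp add: measure_restrict_space)
qed

context homogeneous_lagrangian begin

text \<open>Here periodicity becomes zero mean velocity. The fundamental theorem yields a gauge
  integral and measurability; Lebesgue integrability follows from the bound by 1 plus the integrable
  power.\<close>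

lemma velocity_coordinate:
  assumes y: "y \<in> Lambda_space \<sigma>"
  shows "integrable (lebesgue_on {0..1}) (\<lambda>t. \<bar>velocity y t $ i\<bar> powr \<sigma>)"
    and "integrable (lebesgue_on {0..1}) (\<lambda>t. velocity y t $ i)"
    and "integral\<^sup>L (lebesgue_on {0..1}) (\<lambda>t. velocity y t $ i) = 0"
proof -
  let ?f = "\<lambda>s. y s $ i"
  have v: "velocity y t $ i = deriv ?f t" for t by (simp add: velocity_def)
  have ac: "abs_continuous_on_interval 0 1 ?f"
    and int: "set_integrable lebesgue {0..1} (\<lambda>t. \<bar>deriv ?f t\<bar> powr \<sigma>)" and per: "y 0 = y 1"
    using y by (auto simp: Lambda_space_def H_space_def)
  show p: "integrable (lebesgue_on {0..1}) (\<lambda>t. \<bar>velocity y t $ i\<bar> powr \<sigma>)"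
    using int by (simp add: lebesgue_on_iff v)
  have hk: "(deriv ?f has_integral 0) {0..1}"
    using abs_continuous_has_integral_deriv[OF _ ac] per by simp
  then have meas: "deriv ?f \<in> borel_measurable (lebesgue_on {0..1})"
    using has_integral_implies_lebesgue_measurable_cbox[of "deriv ?f" 0 0 1] by simp
  have "integrable (lebesgue_on {0..1}) (deriv ?f)"
  proof (rule Bochner_Integration.integrable_bound)
    show "integrable (lebesgue_on {0..1}) (\<lambda>t. 1 + \<bar>velocity y t $ i\<bar> powr \<sigma>)"
      using p by (intro Bochner_Integration.integrable_add lebesgue_on_unit_interval_const)
    show "AE t in lebesgue_on {0..1}. norm (deriv ?f t) \<le> norm (1 + \<bar>velocity y t $ i\<bar> powr \<sigma>)"
      using abs_le_one_plus_abs_powr[OF sigma] by (auto simp: v intro!: AE_I2)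
  qed (rule meas)
  then show i: "integrable (lebesgue_on {0..1}) (\<lambda>t. velocity y t $ i)" by (simp add: v)
  then have "set_integrable lebesgue {0..1} (deriv ?f)" by (simp add: lebesgue_on_iff v)
  then have "(LINT t:{0..1}|lebesgue. deriv ?f t) = 0"
    using set_lebesgue_integral_eq_integral(2) hk by (metis integral_unique)
  then show "integral\<^sup>L (lebesgue_on {0..1}) (\<lambda>t. velocity y t $ i) = 0"
    by (simp add: lebesgue_on_iff v)
qed

definition optimal_motion :: "(real \<Rightarrow> real ^ 'n) \<Rightarrow> real \<Rightarrow> real ^ 'n" where
  "optimal_motion y t = velocity y t + vec (u (velocity y t))"

lemma optimal_motion_balanced: "optimal_motion y t \<in> balanced"
  unfolding optimal_motion_def by (rule balanced_shift)

text \<open>In every coordinate \<open>u\<close> is the difference of the optimal motion and the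
  velocity, and the velocity has mean 0; so all coordinates share the mean \<open>mean_u\<close>.
  The cost is integrable because the optimal shift does not exceed the cost at shift 0.\<close>

lemma optimal_motion_integrals:
  assumes y: "y \<in> Lambda_space \<sigma>"
  shows "integrable (lebesgue_on {0..1}) (\<lambda>t. optimal_motion y t $ i)"
    and "integral\<^sup>L (lebesgue_on {0..1}) (\<lambda>t. optimal_motion y t $ i) = mean_u \<sigma> m y"
    and "integrable (lebesgue_on {0..1}) (\<lambda>t. cost (optimal_motion y t))"
    and "integral\<^sup>L (lebesgue_on {0..1}) (\<lambda>t. cost (optimal_motion y t)) = - mean_hamiltonian \<sigma> m y"
proof -
  let ?M = "lebesgue_on {0..1::real}"
  note vel = velocity_coordinate[OF y]
  have meas_v: "velocity y \<in> borel_measurable ?M"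
  proof (rule borel_measurable_euclidean_space[THEN iffD2], rule ballI)
    fix b :: "real ^ 'n" assume "b \<in> Basis"
    then obtain i where "b = axis i 1" by (auto simp: Basis_vec_def)
    then show "(\<lambda>t. velocity y t \<bullet> b) \<in> borel_measurable ?M"
      using vel(2)[of i] by (simp add: inner_axis borel_measurable_integrable)
  qed
  have meas_u: "(\<lambda>t. u (velocity y t)) \<in> borel_measurable ?M"
    using measurable_compose[OF meas_v borel_measurable_u] .
  have meas_vec: "vec \<in> borel_measurable (borel :: real measure)"
    by (intro borel_measurable_continuous_onI) (auto simp: vec_def intro!: continuous_intros)
  have meas_w: "optimal_motion y \<in> borel_measurable ?M"
    unfolding optimal_motion_def[abs_def]
    using meas_v measurable_compose[OF meas_u meas_vec] by (rule borel_measurable_add)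
  have meas_c: "(\<lambda>t. cost (optimal_motion y t)) \<in> borel_measurable ?M"
    using measurable_compose[OF meas_w borel_measurable_continuous_onI[OF continuous_on_cost]] .
  have int_cv: "integrable ?M (\<lambda>t. cost (velocity y t))"
    unfolding cost_def using vel(1) by (intro Bochner_Integration.integrable_sum integrable_mult_right)
  show int_c: "integrable ?M (\<lambda>t. cost (optimal_motion y t))"
  proof (rule Bochner_Integration.integrable_bound[OF int_cv meas_c])
    have "cost (optimal_motion y t) \<le> cost (velocity y t)" for t
      using u_opt_minimizes[of "velocity y t" 0] by (simp add: optimal_motion_def)
    then show "AE t in ?M. norm (cost (optimal_motion y t)) \<le> norm (cost (velocity y t))"
      using cost_nonneg by simp
  qed
  have meas_wi: "(\<lambda>t. optimal_motion y t $ i) \<in> borel_measurable ?M" for i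
    using measurable_compose[OF meas_w borel_measurable_continuous_onI, of "\<lambda>v. v $ i"]
    by (simp add: continuous_on_component)
  show int_w: "integrable ?M (\<lambda>t. optimal_motion y t $ i)" for i
  proof (rule Bochner_Integration.integrable_bound[OF _ meas_wi])
    show "integrable ?M (\<lambda>t. 1 + cost (optimal_motion y t) / m $ i)"
      using int_c by (intro Bochner_Integration.integrable_add integrable_divide_zero lebesgue_on_unit_interval_const) simp_all
    have "\<bar>optimal_motion y t $ i\<bar> \<le> 1 + cost (optimal_motion y t) / m $ i" for t
    proof -
      have "\<bar>optimal_motion y t $ i\<bar> powr \<sigma> \<le> cost (optimal_motion y t) / m $ i"
        using cost_coordinate[of i "optimal_motion y t"] mass_pos[of i]
        by (simp add: pos_le_divide_eq mult.commute)
      then show ?thesis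
        using abs_le_one_plus_abs_powr[OF sigma, of "optimal_motion y t $ i"] by linarith
    qed
    then show "AE t in ?M. norm (optimal_motion y t $ i) \<le> norm (1 + cost (optimal_motion y t) / m $ i)"
      by (auto intro!: AE_I2 order_trans[OF _ abs_ge_self])
  qed
  have "u (velocity y t) = optimal_motion y t $ i - velocity y t $ i" for t i
    by (simp add: optimal_motion_def)
  then have "mean_u \<sigma> m y = integral\<^sup>L ?M (\<lambda>t. optimal_motion y t $ i - velocity y t $ i)" for i
    unfolding mean_u_def lebesgue_on_iff by presburger
  also have "\<dots> i = integral\<^sup>L ?M (\<lambda>t. optimal_motion y t $ i)" for i
    using int_w vel by simp
  finally show "integral\<^sup>L ?M (\<lambda>t. optimal_motion y t $ i) = mean_u \<sigma> m y" by simp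
  show "integral\<^sup>L ?M (\<lambda>t. cost (optimal_motion y t)) = - mean_hamiltonian \<sigma> m y"
    unfolding mean_hamiltonian_def lebesgue_on_iff hamiltonian_zero by (simp add: optimal_motion_def)
qed

section \<open>The hull of the moments\<close>

text \<open>The normalised moments \<open>(1, w, cost w) / (1 + cost w)\<close> of balanced \<open>w\<close>, together with their
  limit \<open>(0, 0, 1)\<close> as \<open>w\<close> tends to infinity. The substitution \<open>z = w / (1 + cost w) powr (1 / \<sigma>)\<close> turns
  this into the continuous image of a compact set.\<close>

definition moment_chart :: "real ^ 'n \<Rightarrow> real \<times> (real ^ 'n) \<times> real" where
  "moment_chart z = (1 - cost z, (1 - cost z) powr (1 - 1 / \<sigma>) *\<^sub>R z, cost z)"

definition moment_set :: "(real \<times> (real ^ 'n) \<times> real) set" where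
  "moment_set = moment_chart ` (balanced \<inter> {z. cost z \<le> 1})"

lemma compact_moment_set: "compact moment_set"
  unfolding moment_set_def
proof (rule compact_continuous_image)
  \<comment> \<open>This makes the exponent in the chart positive, hence the chart continuous also
    where \<open>cost z = 1\<close>, the place of the point at infinity.\<close>
  have "1 / \<sigma> < 1" using sigma by simp
  then show "continuous_on (balanced \<inter> {z. cost z \<le> 1}) moment_chart"
    unfolding moment_chart_def[abs_def]
    by (intro continuous_intros continuous_on_powr') auto
  have "closed {z. cost z \<le> 1}" by (intro closed_Collect_le continuous_intros)
  moreover have "bounded (balanced \<inter> {z. cost z \<le> 1})"
    using bounded_cost_sublevel by (rule bounded_subset) simp
  ultimately show "compact (balanced \<inter> {z. cost z \<le> 1})"
    by (simp add: compact_eq_bounded_closed closed_balanced closed_Int)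
qed

lemma powr_root_inverse:
  assumes "s > 0"
  shows "(s powr (- 1 / \<sigma>)) powr \<sigma> = inverse s"
proof -
  have "(s powr (- 1 / \<sigma>)) powr \<sigma> = s powr (- 1 / \<sigma> * \<sigma>)" by (rule powr_powr)
  also have "- 1 / \<sigma> * \<sigma> = - 1" using sigma by simp
  finally show ?thesis using assms by (simp add: powr_minus)
qed

lemma moment_in_moment_set:
  assumes w: "w \<in> balanced"
  shows "(1 / (1 + cost w)) *\<^sub>R (1, w, cost w) \<in> moment_set"
proof -
  define s where "s = 1 + cost w"
  have s: "s > 0" using cost_nonneg[of w] by (simp add: s_def)
  have s0: "s \<noteq> 0" and \<sigma>0: "\<sigma> \<noteq> 0" using s sigma by auto
  \<comment> \<open>By homogeneity this has cost \<open>cost w / s\<close>, so that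
    \<open>1 - cost z\<close> is the required factor \<open>1 / s\<close>.\<close>
  define z where "z = s powr (- 1 / \<sigma>) *\<^sub>R w"
  have "cost z = (s powr (- 1 / \<sigma>)) powr \<sigma> * cost w" by (simp add: z_def cost_scaleR)
  also have "(s powr (- 1 / \<sigma>)) powr \<sigma> = inverse s"
    using s by (rule powr_root_inverse)
  finally have cz: "cost z = cost w / s" by (simp add: field_simps)
  then have cz1: "1 - cost z = 1 / s" using s by (simp add: s_def field_simps)
  have "(1 / s) powr x = s powr (- x)" for x
    using s by (simp add: powr_divide powr_minus_divide)
  then have "(1 / s) powr (1 - 1 / \<sigma>) * s powr (- 1 / \<sigma>) = s powr (- (1 - 1 / \<sigma>)) * s powr (- 1 / \<sigma>)"
    by simp
  also have "\<dots> = s powr (- 1)" by (simp flip: powr_add)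
  also have "\<dots> = 1 / s" using s by (simp add: powr_minus_divide)
  finally have e: "(1 / s) powr (1 - 1 / \<sigma>) * s powr (- 1 / \<sigma>) = 1 / s" .
  have "moment_chart z = (1 / s, ((1 / s) powr (1 - 1 / \<sigma>) * s powr (- 1 / \<sigma>)) *\<^sub>R w, cost w / s)"
    unfolding moment_chart_def cz1 unfolding cz by (simp add: z_def)
  then have "moment_chart z = (1 / (1 + cost w)) *\<^sub>R (1, w, cost w)"
    unfolding e by (simp add: s_def)
  moreover have "z \<in> balanced" unfolding z_def by (rule balanced_scaleR[OF w])
  moreover have "cost z \<le> 1"
  proof -
    have "0 < 1 / s" using s by simp
    then show ?thesis using cz1 by linarith
  qed
  ultimately show ?thesis
    unfolding moment_set_def by (metis IntI image_eqI mem_Collect_eq)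
qed

text \<open>Inverts the chart: \<open>cost z = 1\<close> gives the point at infinity, and otherwise
  rescaling \<open>z\<close> by \<open>(1 - cost z) powr (- 1 / \<sigma>)\<close> recovers
  \<open>w\<close>.\<close>

lemma moment_set_cases:
  assumes "p \<in> moment_set"
  obtains "p = (0, 0, 1)"
  | w where "w \<in> balanced" "fst p > 0" "p = fst p *\<^sub>R (1, w, cost w)"
proof -
  obtain z where z: "z \<in> balanced" "cost z \<le> 1" "p = moment_chart z"
    using assms by (auto simp: moment_set_def)
  define s where "s = 1 - cost z"
  show thesis
  proof (cases "s = 0")
    case True
    then show thesis using z by (intro that(1)) (simp add: moment_chart_def s_def)
  next
    case False
    then have s: "s > 0" using z by (simp add: s_def)
    define w where "w = s powr (- 1 / \<sigma>) *\<^sub>R z"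
    have "cost w = (s powr (- 1 / \<sigma>)) powr \<sigma> * cost z" by (simp add: w_def cost_scaleR)
    also have "(s powr (- 1 / \<sigma>)) powr \<sigma> = inverse s"
      using s by (rule powr_root_inverse)
    finally have "s * cost w = cost z" using s by simp
    moreover have "s * s powr (- 1 / \<sigma>) = s powr (1 - 1 / \<sigma>)"
      using s powr_add[of s 1 "- 1 / \<sigma>"] by simp
    ultimately have "p = s *\<^sub>R (1, w, cost w)" "fst p = s"
      using z by (simp_all add: moment_chart_def w_def s_def)
    then show thesis
      using s balanced_scaleR[OF z(1)] by (intro that(2)[of w]) (simp_all add: w_def)
  qed
qed

text \<open>A hyperplane separating the moment from the hull would separate it from all the moments of
  which it is the mean.\<close>

lemma mean_moment_in_hull:
  assumes y: "y \<in> Lambda_space \<sigma>" and c: "mean_u \<sigma> m y \<noteq> 0"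
    and J: "J = - mean_hamiltonian \<sigma> m y / \<bar>mean_u \<sigma> m y\<bar> powr \<sigma>"
  shows "J \<ge> 0" and "(1 / (1 + J)) *\<^sub>R (1, vec 1, J) \<in> convex hull moment_set"
proof -
  let ?M = "lebesgue_on {0..1::real}"
  define c where "c = mean_u \<sigma> m y"
  have c0: "c \<noteq> 0" using c by (simp add: c_def)
  \<comment> \<open>Normalises the mean to \<open>vec 1\<close>. The number \<open>c\<close> may be
    negative, and the cone admits any real factor.\<close>
  define s where "s t = (1 / c) *\<^sub>R optimal_motion y t" for t
  note om = optimal_motion_integrals[OF y]
  have s_bal: "s t \<in> balanced" for t
    unfolding s_def by (rule balanced_scaleR[OF optimal_motion_balanced])
  have cost_s: "cost (s t) = cost (optimal_motion y t) / \<bar>c\<bar> powr \<sigma>" for t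
    using c0 by (simp add: s_def cost_scaleR powr_divide)
  have int_cost: "integrable ?M (\<lambda>t. cost (s t))" "integral\<^sup>L ?M (\<lambda>t. cost (s t)) = J"
    using om(3,4) by (simp_all add: cost_s J c_def)
  have int_s: "integrable ?M (\<lambda>t. s t $ i)" "integral\<^sup>L ?M (\<lambda>t. s t $ i) = 1" for i
    using om(1,2)[of i] c0 by (simp_all add: s_def c_def)
  show J0: "J \<ge> 0"
    unfolding int_cost(2)[symmetric] by (rule Bochner_Integration.integral_nonneg) (rule cost_nonneg)
  show "(1 / (1 + J)) *\<^sub>R (1, vec 1, J) \<in> convex hull moment_set"
  proof (rule ccontr)
    let ?q = "(1 / (1 + J)) *\<^sub>R (1, vec 1 :: real ^ 'n, J)"
    assume "?q \<notin> convex hull moment_set"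
    moreover have "closed (convex hull moment_set)"
      by (intro compact_imp_closed compact_convex_hull compact_moment_set)
    ultimately obtain a b where ab: "inner a ?q < b" "\<And>x. x \<in> convex hull moment_set \<Longrightarrow> inner a x > b"
      using separating_hyperplane_closed_point[OF convex_convex_hull] by blast
    obtain a0 a1 a2 where a: "a = (a0, a1, a2)" by (cases a)
    \<comment> \<open>Multiplied by \<open>1 + cost (s t)\<close>, the separating inequality is
      linear in the moments and can be integrated.\<close>
    have pt: "b * (1 + cost (s t)) \<le> a0 + (\<Sum>i\<in>UNIV. a1 $ i * s t $ i) + a2 * cost (s t)" for t
    proof -
      have "(1 / (1 + cost (s t))) *\<^sub>R (1, s t, cost (s t)) \<in> convex hull moment_set"
        using moment_in_moment_set[OF s_bal] by (rule hull_inc)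
      then have "b < inner a ((1 / (1 + cost (s t))) *\<^sub>R (1, s t, cost (s t)))" by (rule ab(2))
      also have "\<dots> = (a0 + (\<Sum>i\<in>UNIV. a1 $ i * s t $ i) + a2 * cost (s t)) / (1 + cost (s t))"
        unfolding a inner_scaleR_right by (simp add: inner_vec_def)
      finally show ?thesis using cost_nonneg[of "s t"] by (simp add: pos_less_divide_eq less_imp_le)
    qed
    have "b * (1 + J) = integral\<^sup>L ?M (\<lambda>t. b * (1 + cost (s t)))"
      using int_cost by (simp add: measure_restrict_space)
    also have "\<dots> \<le> integral\<^sup>L ?M (\<lambda>t. a0 + (\<Sum>i\<in>UNIV. a1 $ i * s t $ i) + a2 * cost (s t))"
      using int_cost int_s pt
      by (intro integral_mono Bochner_Integration.integrable_add Bochner_Integration.integrable_sum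
          integrable_mult_right lebesgue_on_unit_interval_const)
    also have "\<dots> = a0 + (\<Sum>i\<in>UNIV. a1 $ i) + a2 * J"
      using int_cost int_s by (simp add: measure_restrict_space)
    also have "\<dots> = (1 + J) * inner a ?q"
      using J0 unfolding a inner_scaleR_right by (simp add: inner_vec_def)
    also have "\<dots> < (1 + J) * b" using J0 ab(1) by (intro mult_strict_left_mono) auto
    finally show False by simp
  qed
qed

section \<open>From the hull back to loops\<close>

text \<open>A hull point is a finite combination. Its points at infinity contribute only to the
  third coordinate, so omitting them keeps the mean and can only lower the cost, whence
  \<open>\<le>\<close> instead of equality.\<close>

lemma hull_point_realized:
  assumes p: "(p0, p0 *\<^sub>R vec 1, p1) \<in> convex hull moment_set" and p0: "p0 > 0"
  obtains y where "y \<in> Lambda_space \<sigma>" "mean_u \<sigma> m y = 1"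
    "1 < - mean_hamiltonian \<sigma> m y" "- mean_hamiltonian \<sigma> m y \<le> p1 / p0"
proof -
  obtain S b where S: "finite S" "S \<subseteq> moment_set" "\<And>x. x \<in> S \<Longrightarrow> 0 \<le> b x"
      "(\<Sum>x\<in>S. b x *\<^sub>R x) = (p0, p0 *\<^sub>R vec 1, p1)"
    using p unfolding convex_hull_explicit by auto
  \<comment> \<open>Points of weight 0 go as well, since the phases of the loop need positive
    duration.\<close>
  define S' where "S' = {x \<in> S. fst x > 0 \<and> b x > 0}"
  have finS': "finite S'" "S' \<subseteq> S" using S by (auto simp: S'_def)
  have "\<exists>w. w \<in> balanced \<and> x = fst x *\<^sub>R (1, w, cost w)" if "x \<in> S'" for x
  proof -
    have "x \<in> moment_set" "fst x \<noteq> 0" using that S by (auto simp: S'_def)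
    then show ?thesis by (elim moment_set_cases) auto
  qed
  then obtain w where w: "\<And>x. x \<in> S' \<Longrightarrow> w x \<in> balanced"
    "\<And>x. x \<in> S' \<Longrightarrow> x = fst x *\<^sub>R (1, w x, cost (w x))" by metis
  have snd_w: "fst (snd x) = fst x *\<^sub>R w x" "snd (snd x) = fst x * cost (w x)" if "x \<in> S'" for x
    using w(2)[OF that] by (metis fst_scaleR snd_scaleR fst_conv snd_conv real_scaleR_def)+
  have outside: "b x *\<^sub>R fst x = 0 \<and> b x *\<^sub>R fst (snd x) = 0 \<and> 0 \<le> b x * snd (snd x)"
    if "x \<in> S - S'" for x
  proof (cases "b x = 0")
    case False
    then have "b x > 0" using S(3)[of x] that by simp
    moreover have "x \<in> moment_set" using that S by auto
    ultimately show ?thesis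
      using that by (elim moment_set_cases) (auto simp: S'_def)
  qed simp
  \<comment> \<open>Undoes the normalisation: \<open>fst x\<close> is the factor in front of
    \<open>(1, w x, cost (w x))\<close>, and division by \<open>p0\<close> makes the total weight
    1.\<close>
  define \<mu> where "\<mu> x = b x * fst x / p0" for x
  have \<mu>: "\<mu> x > 0" if "x \<in> S'" for x using that p0 by (auto simp: \<mu>_def S'_def)
  have "(\<Sum>x\<in>S'. b x * fst x) = (\<Sum>x\<in>S. b x * fst x)"
    using S(1) finS' outside by (intro sum.mono_neutral_left) auto
  also have "\<dots> = p0" using arg_cong[OF S(4), of fst] by (simp add: fst_sum)
  finally have "(\<Sum>x\<in>S'. b x * fst x) = p0" .
  then have sum1: "sum \<mu> S' = 1" using p0 by (simp add: \<mu>_def flip: sum_divide_distrib)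
  have "(\<Sum>x\<in>S'. b x *\<^sub>R fst (snd x)) = (\<Sum>x\<in>S. b x *\<^sub>R fst (snd x))"
    using S(1) finS' outside by (intro sum.mono_neutral_left) auto
  also have "\<dots> = p0 *\<^sub>R vec 1" using arg_cong[OF S(4), of "\<lambda>x. fst (snd x)"] by (simp add: fst_sum snd_sum)
  finally have "(1 / p0) *\<^sub>R (\<Sum>x\<in>S'. b x *\<^sub>R fst (snd x)) = vec 1" using p0 by simp
  then have mean1: "(\<Sum>x\<in>S'. \<mu> x *\<^sub>R w x) = vec 1"
    unfolding scaleR_sum_right by (simp add: snd_w \<mu>_def cong: sum.cong)
  have "(\<Sum>x\<in>S'. b x * snd (snd x)) \<le> (\<Sum>x\<in>S. b x * snd (snd x))"
    using S(1) finS' outside by (intro sum_mono2) auto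
  also have "\<dots> = p1" using arg_cong[OF S(4), of "\<lambda>x. snd (snd x)"] by (simp add: snd_sum)
  finally have "(\<Sum>x\<in>S'. b x * snd (snd x)) / p0 \<le> p1 / p0" using p0 by (simp add: divide_right_mono)
  then have cost_le: "(\<Sum>x\<in>S'. \<mu> x * cost (w x)) \<le> p1 / p0"
    by (simp add: sum_divide_distrib snd_w \<mu>_def mult.assoc cong: sum.cong)
  have ne: "S' \<noteq> {}" using sum1 by auto
  \<comment> \<open>The average of the tangent bounds; as the mean of the \<open>w x\<close> is
    \<open>vec 1\<close>, their linear part vanishes.\<close>
  have "(\<Sum>x\<in>S'. \<mu> x * (1 + \<sigma> * ((\<Sum>i\<in>UNIV. m $ i * w x $ i) - 1))) < (\<Sum>x\<in>S'. \<mu> x * cost (w x))"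
    using finS' ne \<mu> cost_gt_tangent[OF w(1)] by (intro sum_strict_mono mult_strict_left_mono) auto
  also have "(\<Sum>x\<in>S'. \<mu> x * (1 + \<sigma> * ((\<Sum>i\<in>UNIV. m $ i * w x $ i) - 1))) =
      sum \<mu> S' + \<sigma> * ((\<Sum>i\<in>UNIV. m $ i * (\<Sum>x\<in>S'. \<mu> x *\<^sub>R w x) $ i) - sum \<mu> S')"
  proof -
    have "(\<Sum>i\<in>UNIV. m $ i * (\<Sum>x\<in>S'. \<mu> x *\<^sub>R w x) $ i) = (\<Sum>x\<in>S'. \<mu> x * (\<Sum>i\<in>UNIV. m $ i * w x $ i))"
      unfolding sum_component vector_scaleR_component real_scaleR_def sum_distrib_left
      by (subst sum.swap) (simp add: mult_ac)
    then show ?thesis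
      by (simp add: algebra_simps sum.distrib sum_subtractf sum_distrib_left)
  qed
  also have "\<dots> = 1" by (simp add: sum1 mean1 mass_sum)
  finally have cost_gt: "1 < (\<Sum>x\<in>S'. \<mu> x * cost (w x))" .
  \<comment> \<open>The phases get the velocities \<open>w x - vec 1\<close>, which average to 0 and
    have optimal shift 1.\<close>
  have mean0: "(\<Sum>x\<in>S'. \<mu> x *\<^sub>R (w x - vec 1)) = 0"
    by (simp add: scaleR_diff_right sum_subtractf mean1 sum1 flip: scaleR_sum_left)
  show thesis
  proof (rule piecewise_linear_loop_finite[OF finS'(1) \<mu> sum1 mean0, where \<sigma> = \<sigma>])
    fix y :: "real \<Rightarrow> real ^ 'n"
    assume y: "y \<in> Lambda_space \<sigma>"
      "\<And>F :: real ^ 'n \<Rightarrow> real. (LINT t:{0..1}|lebesgue. F (velocity y t)) = (\<Sum>x\<in>S'. \<mu> x * F (w x - vec 1))"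
    have "mean_u \<sigma> m y = sum \<mu> S'"
      unfolding mean_u_def y(2)
      by (intro sum.cong refl) (simp only: balanced_minus_vec(1)[OF w(1)] mult_1_right)
    then have "mean_u \<sigma> m y = 1" by (simp add: sum1)
    moreover have "- mean_hamiltonian \<sigma> m y = (\<Sum>x\<in>S'. \<mu> x * cost (w x))"
      unfolding mean_hamiltonian_def y(2) sum_negf[symmetric]
      by (intro sum.cong refl)
        (simp only: balanced_minus_vec(2)[OF w(1)] mult_minus_right minus_minus)
    ultimately show thesis using y(1) cost_le cost_gt by (intro that[of y]) simp_all
  qed
qed

text \<open>A point of \<open>P\<close> with first coordinate \<open>r > 0\<close> stands for the
  cost \<open>(1 - r) / r\<close>, which decreases in \<open>r\<close>. The largest first coordinate
  on the compact set \<open>P\<close> thus gives the least cost, and the efficiency is its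
  reciprocal.\<close>

theorem efficiency_maximizer:
  assumes "mobilized \<sigma> m"
  obtains y where "y \<in> efficiency_domain \<sigma> m" "ereal (efficiency \<sigma> m y) = max_efficiency \<sigma> m"
    "max_efficiency \<sigma> m < 1"
proof -
  \<comment> \<open>The slice of the hull on which the normalised mean of \<open>w\<close> is
    \<open>vec 1\<close>, the constraint satisfied by every loop rescaled to mean shift 1.\<close>
  define P where "P = convex hull moment_set \<inter> {p. p = (fst p, fst p *\<^sub>R vec 1, 1 - fst p)}"
  have in_P: "\<exists>J>0. efficiency \<sigma> m y = 1 / J \<and> (1 / (1 + J)) *\<^sub>R (1, vec 1, J) \<in> P"
    if y: "y \<in> efficiency_domain \<sigma> m" and c: "mean_u \<sigma> m y \<noteq> 0" for y
  proof -
    define J where "J = - mean_hamiltonian \<sigma> m y / \<bar>mean_u \<sigma> m y\<bar> powr \<sigma>"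
    have yL: "y \<in> Lambda_space \<sigma>" and H: "mean_hamiltonian \<sigma> m y \<noteq> 0"
      using y by (auto simp: efficiency_domain_def)
    note J = mean_moment_in_hull[OF yL c J_def]
    have "J > 0" using J(1) H c by (auto simp: J_def less_le)
    moreover have "efficiency \<sigma> m y = 1 / J" using c by (simp add: efficiency_def J_def)
    moreover have "J / (1 + J) = 1 - 1 / (1 + J)" using \<open>J > 0\<close> by (simp add: field_simps)
    then have "(1 / (1 + J)) *\<^sub>R (1, vec 1 :: real ^ 'n, J) \<in> P" using J(2) by (simp add: P_def)
    ultimately show ?thesis by blast
  qed
  obtain y0 where y0: "y0 \<in> efficiency_domain \<sigma> m" "efficiency \<sigma> m y0 > 0"
    using assms mobilized_iff by blast
  then have "mean_u \<sigma> m y0 \<noteq> 0" by (auto simp: efficiency_def)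
  then obtain J0 where J0: "J0 > 0" "(1 / (1 + J0)) *\<^sub>R (1, vec 1, J0) \<in> P"
    using in_P y0 by blast
  have "compact P"
    unfolding P_def
    by (intro compact_Int_closed compact_convex_hull compact_moment_set closed_Collect_eq continuous_intros)
  then obtain p where p: "p \<in> P" "\<And>q. q \<in> P \<Longrightarrow> fst q \<le> fst p"
    using continuous_attains_sup[of P fst] J0(2) continuous_on_fst[OF continuous_on_id] by blast
  \<comment> \<open>The mobilized loop \<open>y0\<close> is what excludes a maximum at first
    coordinate 0, where no cost could be recovered.\<close>
  have "1 / (1 + J0) \<le> fst p" using p(2)[OF J0(2)] by simp
  then have p0: "fst p > 0" using J0(1) by (smt (verit) zero_less_divide_1_iff)
  have "(fst p, fst p *\<^sub>R vec 1, 1 - fst p) \<in> convex hull moment_set"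
    using p(1) unfolding P_def by auto
  then obtain y where y: "y \<in> Lambda_space \<sigma>" "mean_u \<sigma> m y = 1"
    "1 < - mean_hamiltonian \<sigma> m y" "- mean_hamiltonian \<sigma> m y \<le> (1 - fst p) / fst p"
    using hull_point_realized p0 by metis
  define C where "C = - mean_hamiltonian \<sigma> m y"
  have C: "1 < C" "C \<le> (1 - fst p) / fst p" using y by (simp_all add: C_def)
  have dom: "y \<in> efficiency_domain \<sigma> m" using y by (auto simp: efficiency_domain_def)
  have eff: "efficiency \<sigma> m y = 1 / C" using y by (simp add: efficiency_def C_def)
  have best: "efficiency \<sigma> m y' \<le> 1 / C" if y': "y' \<in> efficiency_domain \<sigma> m" for y'
  proof (cases "mean_u \<sigma> m y' = 0")
    \<comment> \<open>A loop with mean shift 0 cannot be rescaled to mean 1, but its efficiency is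
      0.\<close>
    case True
    then show ?thesis using C by (simp add: efficiency_def)
  next
    case False
    then obtain J where J: "J > 0" "efficiency \<sigma> m y' = 1 / J" "(1 / (1 + J)) *\<^sub>R (1, vec 1, J) \<in> P"
      using in_P y' by blast
    have "1 / (1 + J) \<le> fst p" using p(2)[OF J(3)] by simp
    then have "1 \<le> fst p + fst p * J" using J(1) by (simp add: field_simps)
    then have "(1 - fst p) / fst p \<le> J" using p0 by (simp add: field_simps)
    then have "C \<le> J" using C by simp
    then show ?thesis unfolding J(2) using C by (simp add: frac_le)
  qed
  have max: "max_efficiency \<sigma> m = ereal (1 / C)"
    unfolding max_efficiency_def
  proof (rule SUP_eqI)
    show "ereal (efficiency \<sigma> m y') \<le> ereal (1 / C)" if "y' \<in> efficiency_domain \<sigma> m" for y'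
      using best[OF that] by simp
    show "ereal (1 / C) \<le> z" if "\<And>y'. y' \<in> efficiency_domain \<sigma> m \<Longrightarrow> ereal (efficiency \<sigma> m y') \<le> z" for z
      using that[OF dom] unfolding eff .
  qed
  show thesis
    by (rule that[OF dom]) (use C in \<open>simp_all add: max eff\<close>)
qed

end

theorem theorem2:
  fixes \<sigma> :: real and m :: "real ^ 'n"
  assumes "\<sigma> > 1"
    and "\<And>i. 0 < m $ i \<and> m $ i < 1"
    and "(\<Sum>i\<in>UNIV. m $ i) = 1"
    and "mobilized \<sigma> m"
  shows "(\<exists>y\<in>efficiency_domain \<sigma> m. ereal (efficiency \<sigma> m y) = max_efficiency \<sigma> m) \<and>
         max_efficiency \<sigma> m < 1"
proof -
  interpret homogeneous_lagrangian \<sigma> m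
    by standard (use assms(1-3) in auto)
  show ?thesis
    using efficiency_maximizer[OF assms(4)] by blast
qed

end
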